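(* For any first-order structure $M$, the set $\mathcal{MA}^*(M)$ is closed under existential quantification: if $\varphi(x,\bar y)\in\mathcal{MA}^*(M)$, then $\exists x\,\varphi(x,\bar y)\in\mathcal{MA}^*(M)$. Thus, the structure with universe $M$, together with the sets definable by formulas in $\mathcal{MA}^*(M)$, is a reduct of the canonical expansion $M_M$.
   Context: Let $M$ be an $L$-structure. $L(M)$ is $L$ with a constant symbol for each element of $M$, and $M_M$ is the canonical expansion of $M$ to an $L(M)$-structure. For a set $A$ and $n\ge1$, a subset $B\subseteq A^n$ is mutually algebraic if there is an integer $K$ such that for every partition $X\sqcup Y=\{1,\dots,n\}$ into two nonempty disjoint sets, the projection $\pi_Y$ onto the coordinates in $Y$, restricted to $B$, is at most $K$-to-1. An $L(M)$-formula $\varphi(\bar z)$ (with displayed tuple of distinct variables, $\lg(\bar z)\ge1$) is mutually algebraic if $\varphi(M)=\{\bar a\in M^{\lg(\bar z)}:M\models\varphi(\bar a)\}$ is a mutually algebraic subset of $M^{\lg(\bar z)}$; $\mathcal{MA}(M)$ is the set of all mutually algebraic $L(M)$-formulas. (Mutual algebraicity depends on the displayed tuple of variables: it is not preserved under adding dummy variables.) $\mathcal{MA}^*(M)$ is the set of all $L(M)$-formulas that are $Th(M_M)$-equivalent to a boolean combination of formulas from $\mathcal{MA}(M)$ (the formulas in the combination may use different subtuples of the free variables). Being a reduct of $M_M$ means that the specified family of subsets of powers of $M$ is the full family of sets definable in a structure with universe $M$, all of whose definable sets are definable in $M_M$. *)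

theory Defs
  imports Main
begin

section \<open>First-order languages, structures and formulas\<close>

text \<open>The symbol sets may be empty, so purely relational and purely functional languages are
  covered. Constant symbols are function symbols of arity 0.\<close>

record ('f, 'r) language =
  fun_syms :: "'f set"
  fun_arity :: "'f \<Rightarrow> nat"
  rel_syms :: "'r set"
  rel_arity :: "'r \<Rightarrow> nat"

datatype 'f trm = Var nat | App 'f "'f trm list"

datatype ('f, 'r) form =
    Equal "'f trm" "'f trm"
  | Rel 'r "'f trm list"
  | Neg "('f, 'r) form"
  | Conj "('f, 'r) form" "('f, 'r) form"
  | Exi nat "('f, 'r) form"

abbreviation Disj :: "('f, 'r) form \<Rightarrow> ('f, 'r) form \<Rightarrow> ('f, 'r) form" where
  "Disj \<phi> \<psi> \<equiv> Neg (Conj (Neg \<phi>) (Neg \<psi>))"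

abbreviation Iff :: "('f, 'r) form \<Rightarrow> ('f, 'r) form \<Rightarrow> ('f, 'r) form" where
  "Iff \<phi> \<psi> \<equiv> Disj (Conj \<phi> \<psi>) (Conj (Neg \<phi>) (Neg \<psi>))"

abbreviation Fall :: "nat \<Rightarrow> ('f, 'r) form \<Rightarrow> ('f, 'r) form" where
  "Fall x \<phi> \<equiv> Neg (Exi x (Neg \<phi>))"

fun is_term :: "('f, 'r) language \<Rightarrow> 'f trm \<Rightarrow> bool" where
  "is_term L (Var x) \<longleftrightarrow> True"
| "is_term L (App f ts) \<longleftrightarrow>
     f \<in> fun_syms L \<and> length ts = fun_arity L f \<and> (\<forall>t \<in> set ts. is_term L t)"

fun is_formula :: "('f, 'r) language \<Rightarrow> ('f, 'r) form \<Rightarrow> bool" where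
  "is_formula L (Equal s t) \<longleftrightarrow> is_term L s \<and> is_term L t"
| "is_formula L (Rel r ts) \<longleftrightarrow>
     r \<in> rel_syms L \<and> length ts = rel_arity L r \<and> (\<forall>t \<in> set ts. is_term L t)"
| "is_formula L (Neg \<phi>) \<longleftrightarrow> is_formula L \<phi>"
| "is_formula L (Conj \<phi> \<psi>) \<longleftrightarrow> is_formula L \<phi> \<and> is_formula L \<psi>"
| "is_formula L (Exi x \<phi>) \<longleftrightarrow> is_formula L \<phi>"

fun trm_vars :: "'f trm \<Rightarrow> nat set" where
  "trm_vars (Var x) = {x}"
| "trm_vars (App f ts) = (\<Union>t \<in> set ts. trm_vars t)"

fun free_vars :: "('f, 'r) form \<Rightarrow> nat set" where
  "free_vars (Equal s t) = trm_vars s \<union> trm_vars t"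
| "free_vars (Rel r ts) = (\<Union>t \<in> set ts. trm_vars t)"
| "free_vars (Neg \<phi>) = free_vars \<phi>"
| "free_vars (Conj \<phi> \<psi>) = free_vars \<phi> \<union> free_vars \<psi>"
| "free_vars (Exi x \<phi>) = free_vars \<phi> - {x}"

record ('f, 'r, 'a) fo_struct =
  univ :: "'a set"
  fun_interp :: "'f \<Rightarrow> 'a list \<Rightarrow> 'a"
  rel_interp :: "'r \<Rightarrow> 'a list \<Rightarrow> bool"

definition fo_structure :: "('f, 'r) language \<Rightarrow> ('f, 'r, 'a) fo_struct \<Rightarrow> bool" where
  "fo_structure L M \<longleftrightarrow> univ M \<noteq> {} \<and>
     (\<forall>f \<in> fun_syms L. \<forall>as. length as = fun_arity L f \<longrightarrow> set as \<subseteq> univ M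
        \<longrightarrow> fun_interp M f as \<in> univ M)"

fun eval_trm :: "('f, 'r, 'a) fo_struct \<Rightarrow> (nat \<Rightarrow> 'a) \<Rightarrow> 'f trm \<Rightarrow> 'a" where
  "eval_trm M e (Var x) = e x"
| "eval_trm M e (App f ts) = fun_interp M f (map (eval_trm M e) ts)"

fun sat :: "('f, 'r, 'a) fo_struct \<Rightarrow> (nat \<Rightarrow> 'a) \<Rightarrow> ('f, 'r) form \<Rightarrow> bool" where
  "sat M e (Equal s t) \<longleftrightarrow> eval_trm M e s = eval_trm M e t"
| "sat M e (Rel r ts) \<longleftrightarrow> rel_interp M r (map (eval_trm M e) ts)"
| "sat M e (Neg \<phi>) \<longleftrightarrow> \<not> sat M e \<phi>"
| "sat M e (Conj \<phi> \<psi>) \<longleftrightarrow> sat M e \<phi> \<and> sat M e \<psi>"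
| "sat M e (Exi x \<phi>) \<longleftrightarrow> (\<exists>a \<in> univ M. sat M (e(x := a)) \<phi>)"

definition valid_in :: "('f, 'r, 'a) fo_struct \<Rightarrow> ('f, 'r) form \<Rightarrow> bool" where
  "valid_in M \<phi> \<longleftrightarrow> (\<forall>e. (\<forall>x. e x \<in> univ M) \<longrightarrow> sat M e \<phi>)"

section \<open>Definable sets\<close>

text \<open>Elements of the power \<open>A\<^sup>n\<close> are lists of length \<open>n\<close> over \<open>A\<close>.\<close>

definition cart_power :: "'a set \<Rightarrow> nat \<Rightarrow> 'a list set" where
  "cart_power A n = {as. length as = n \<and> set as \<subseteq> A}"

text \<open>A displayed tuple \<open>\<phi>(z\<^sub>1,\<dots>,z\<^sub>n)\<close>: distinct variables, among which are all the free ones.\<close>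

definition displays :: "nat list \<Rightarrow> ('f, 'r) form \<Rightarrow> bool" where
  "displays zs \<phi> \<longleftrightarrow> distinct zs \<and> free_vars \<phi> \<subseteq> set zs"

definition solutions :: "('f, 'r, 'a) fo_struct \<Rightarrow> ('f, 'r) form \<Rightarrow> nat list \<Rightarrow> 'a list set" where
  "solutions M \<phi> zs = {map e zs | e. (\<forall>x. e x \<in> univ M) \<and> sat M e \<phi>}"

text \<open>The subsets of the \<open>n\<close>-th power of the universe definable without parameters.\<close>

definition definable_sets ::
    "('f, 'r) language \<Rightarrow> ('f, 'r, 'a) fo_struct \<Rightarrow> nat \<Rightarrow> 'a list set set" where
  "definable_sets L M n =
     {solutions M \<phi> zs | \<phi> zs. is_formula L \<phi> \<and> displays zs \<phi> \<and> length zs = n}"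

definition is_reduct_of ::
    "('f, 'r) language \<Rightarrow> ('f, 'r, 'a) fo_struct \<Rightarrow>
     ('g, 's) language \<Rightarrow> ('g, 's, 'a) fo_struct \<Rightarrow> bool" where
  "is_reduct_of L' N L M \<longleftrightarrow> fo_structure L' N \<and> univ N = univ M \<and>
     (\<forall>n. definable_sets L' N n \<subseteq> definable_sets L M n)"

section \<open>Theories and equivalence over a theory\<close>

definition theory_of :: "('f, 'r) language \<Rightarrow> ('f, 'r, 'a) fo_struct \<Rightarrow> ('f, 'r) form set" where
  "theory_of L M = {\<sigma>. is_formula L \<sigma> \<and> free_vars \<sigma> = {} \<and> valid_in M \<sigma>}"

definition model_of ::
    "('f, 'r) language \<Rightarrow> ('f, 'r) form set \<Rightarrow> ('f, 'r, 'a) fo_struct \<Rightarrow> bool" where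
  "model_of L T N \<longleftrightarrow> fo_structure L N \<and> (\<forall>\<sigma> \<in> T. valid_in N \<sigma>)"

text \<open>HOL cannot quantify over types inside a formula, so the type in which the universes of the
  models live is a parameter. For \<open>T\<close> the theory of a structure over that type the choice does
  not matter, see \<open>equivalent_over_theory_of\<close> below.\<close>

definition equivalent_over ::
    "'a itself \<Rightarrow> ('f, 'r) language \<Rightarrow> ('f, 'r) form set \<Rightarrow> ('f, 'r) form \<Rightarrow> ('f, 'r) form \<Rightarrow> bool"
  where
  "equivalent_over _ L T \<phi> \<psi> \<longleftrightarrow>
     (\<forall>N :: ('f, 'r, 'a) fo_struct. model_of L T N \<longrightarrow> valid_in N (Iff \<phi> \<psi>))"

lemma finite_trm_vars: "finite (trm_vars t)"
  by (induction t) auto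

lemma finite_free_vars: "finite (free_vars \<phi>)"
  by (induction \<phi>) (auto simp: finite_trm_vars)

lemma valid_in_All: "valid_in N (Fall x \<phi>) \<longleftrightarrow> valid_in N \<phi>"
proof
  assume A: "valid_in N (Fall x \<phi>)"
  show "valid_in N \<phi>"
    unfolding valid_in_def
  proof (intro allI impI)
    fix e :: "nat \<Rightarrow> _" assume e: "\<forall>y. e y \<in> univ N"
    have "sat N (e(x := e x)) \<phi>"
      using A e unfolding valid_in_def sat.simps by blast
    then show "sat N e \<phi>" by simp
  qed
qed (auto simp: valid_in_def)

lemma valid_in_closure: "valid_in N (foldr Fall xs \<phi>) \<longleftrightarrow> valid_in N \<phi>"
  by (induction xs) (simp_all add: valid_in_All del: sat.simps)

lemma free_vars_closure: "free_vars (foldr Fall xs \<phi>) = free_vars \<phi> - set xs"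
  by (induction xs) auto

lemma is_formula_closure: "is_formula L (foldr Fall xs \<phi>) \<longleftrightarrow> is_formula L \<phi>"
  by (induction xs) auto

lemma equivalent_over_theory_of_imp:
  fixes M :: "('f, 'r, 'a) fo_struct" and N :: "('f, 'r, 'b) fo_struct"
  assumes "is_formula L \<phi>" "is_formula L \<psi>" "valid_in M (Iff \<phi> \<psi>)"
    and "model_of L (theory_of L M) N"
  shows "valid_in N (Iff \<phi> \<psi>)"
proof -
  obtain xs where xs: "set xs = free_vars (Iff \<phi> \<psi>)"
    using finite_list[OF finite_free_vars] by blast
  have "foldr Fall xs (Iff \<phi> \<psi>) \<in> theory_of L M"
    using assms(1-3) xs
    by (simp add: theory_of_def valid_in_closure free_vars_closure is_formula_closure)
  then have "valid_in N (foldr Fall xs (Iff \<phi> \<psi>))"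
    using assms(4) by (simp add: model_of_def)
  then show ?thesis by (simp only: valid_in_closure)
qed

lemma equivalent_over_theory_of:
  fixes M :: "('f, 'r, 'a) fo_struct"
  assumes "fo_structure L M" "is_formula L \<phi>" "is_formula L \<psi>"
  shows "equivalent_over TYPE('a) L (theory_of L M) \<phi> \<psi> \<longleftrightarrow> valid_in M (Iff \<phi> \<psi>)"
    and "equivalent_over TYPE('a) L (theory_of L M) \<phi> \<psi> \<Longrightarrow>
         equivalent_over TYPE('b) L (theory_of L M) \<phi> \<psi>"
proof -
  have M: "model_of L (theory_of L M) M"
    using assms(1) by (simp add: model_of_def theory_of_def)
  note * = equivalent_over_theory_of_imp[OF assms(2,3)]
  show "equivalent_over TYPE('a) L (theory_of L M) \<phi> \<psi> \<longleftrightarrow> valid_in M (Iff \<phi> \<psi>)"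
    unfolding equivalent_over_def using M * by blast
  show "equivalent_over TYPE('a) L (theory_of L M) \<phi> \<psi> \<Longrightarrow>
        equivalent_over TYPE('b) L (theory_of L M) \<phi> \<psi>"
    unfolding equivalent_over_def using M * by blast
qed

section \<open>The canonical expansion\<close>

definition expand_lang :: "('f, 'r) language \<Rightarrow> 'a set \<Rightarrow> ('f + 'a, 'r) language" where
  "expand_lang L A =
     \<lparr>fun_syms = Inl ` fun_syms L \<union> Inr ` A,
      fun_arity = case_sum (fun_arity L) (\<lambda>_. 0),
      rel_syms = rel_syms L,
      rel_arity = rel_arity L\<rparr>"

abbreviation lang_over :: "('f, 'r) language \<Rightarrow> ('f, 'r, 'a) fo_struct \<Rightarrow> ('f + 'a, 'r) language"
  where "lang_over L M \<equiv> expand_lang L (univ M)"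

definition canonical_expansion :: "('f, 'r, 'a) fo_struct \<Rightarrow> ('f + 'a, 'r, 'a) fo_struct" where
  "canonical_expansion M =
     \<lparr>univ = univ M,
      fun_interp = case_sum (fun_interp M) (\<lambda>a _. a),
      rel_interp = rel_interp M\<rparr>"

section \<open>Mutual algebraicity\<close>

text \<open>Coordinates are numbered from 0. The projection to the coordinates in \<open>Y\<close> is
  \<open>\<lambda>b. nths b Y\<close>.\<close>

definition mutually_algebraic :: "'a set \<Rightarrow> nat \<Rightarrow> 'a list set \<Rightarrow> bool" where
  "mutually_algebraic A n B \<longleftrightarrow> 1 \<le> n \<and> B \<subseteq> cart_power A n \<and>
     (\<exists>K :: nat. \<forall>X Y. X \<union> Y = {..<n} \<longrightarrow> X \<inter> Y = {} \<longrightarrow> X \<noteq> {} \<longrightarrow> Y \<noteq> {} \<longrightarrow>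
        (\<forall>p. finite {b \<in> B. nths b Y = p} \<and> card {b \<in> B. nths b Y = p} \<le> K))"

text \<open>The displayed tuple is part of the data of an element of \<open>MA\<close>.\<close>

definition MA ::
    "('f, 'r) language \<Rightarrow> ('f, 'r, 'a) fo_struct \<Rightarrow> (('f + 'a, 'r) form \<times> nat list) set" where
  "MA L M =
     {(\<phi>, zs). is_formula (lang_over L M) \<phi> \<and> displays zs \<phi> \<and> 1 \<le> length zs \<and>
        mutually_algebraic (univ M) (length zs) (solutions (canonical_expansion M) \<phi> zs)}"

inductive_set boolean_combinations :: "('f, 'r) form set \<Rightarrow> ('f, 'r) form set"
  for S :: "('f, 'r) form set" where
  base: "\<phi> \<in> S \<Longrightarrow> \<phi> \<in> boolean_combinations S"
| neg: "\<phi> \<in> boolean_combinations S \<Longrightarrow> Neg \<phi> \<in> boolean_combinations S"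
| conj: "\<phi> \<in> boolean_combinations S \<Longrightarrow> \<psi> \<in> boolean_combinations S
    \<Longrightarrow> Conj \<phi> \<psi> \<in> boolean_combinations S"

definition MA_star ::
    "('f, 'r) language \<Rightarrow> ('f, 'r, 'a) fo_struct \<Rightarrow> ('f + 'a, 'r) form set" where
  "MA_star L M =
     {\<phi>. is_formula (lang_over L M) \<phi> \<and>
        (\<exists>\<psi> \<in> boolean_combinations (fst ` MA L M).
           equivalent_over TYPE('a) (lang_over L M)
             (theory_of (lang_over L M) (canonical_expansion M)) \<phi> \<psi>)}"

definition MA_star_sets ::
    "('f, 'r) language \<Rightarrow> ('f, 'r, 'a) fo_struct \<Rightarrow> nat \<Rightarrow> 'a list set set" where
  "MA_star_sets L M n =
     {solutions (canonical_expansion M) \<phi> zs | \<phi> zs.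
        \<phi> \<in> MA_star L M \<and> displays zs \<phi> \<and> length zs = n}"

text \<open>The relational structure with universe \<open>A\<close> whose basic relations are the sets in the family
  \<open>D\<close>. Each \<open>B \<in> D n\<close> gives the \<open>n\<close>-ary relation symbol \<open>(n, B)\<close>, interpreted as \<open>B\<close>.\<close>

definition family_lang :: "(nat \<Rightarrow> 'a list set set) \<Rightarrow> (unit, nat \<times> 'a list set) language" where
  "family_lang D =
     \<lparr>fun_syms = {}, fun_arity = (\<lambda>_. 0), rel_syms = {(n, B). B \<in> D n}, rel_arity = fst\<rparr>"

definition family_struct :: "'a set \<Rightarrow> (unit, nat \<times> 'a list set, 'a) fo_struct" where
  "family_struct A =
     \<lparr>univ = A, fun_interp = (\<lambda>_ _. undefined), rel_interp = (\<lambda>(n, B) as. as \<in> B)\<rparr>"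

end

theory Submission
  imports Defs "HOL-Library.FuncSet"
begin

text \<open>Only the sets of assignments that formulas define matter, so \<open>MA\<close> and \<open>MA_star\<close> are
  translated into such sets: existential quantification over the variable \<open>x\<close> becomes the
  cylindrification \<open>cyl U x\<close>, and the claim is that the boolean algebra \<open>ma_comb\<close> generated by the
  mutually algebraic definable sets is closed under it.

  A set is mutually algebraic as soon as fixing any single coordinate leaves a uniformly bounded
  number of tuples (\<open>mutually_algebraic_iff_nth\<close>). In this form three closure properties are
  immediate: definable subsets with the same variables, projections to a nonempty set of variables,
  and intersections of two sets that share a variable, since a shared coordinate passes the bound
  from one set to the other.

  A boolean combination is a finite union of cells, each the intersection of some generators minus
  the union of the others. Generators that do not involve \<open>x\<close> can be pulled out of the
  cylindrification, and the positive ones that do involve \<open>x\<close> share this variable, so their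
  intersection \<open>A\<close> is again mutually algebraic. It remains to project \<open>A - \<Union>G\<close>, where each member
  of the finite family \<open>G\<close> is mutually algebraic and involves \<open>x\<close>.

  If \<open>A\<close> has a variable besides \<open>x\<close> (\<open>ma_comb_cyl_Diff_nonunary\<close>), then an assignment \<open>e\<close> is
  classified by the set \<open>H\<close> of those \<open>B \<in> G\<close> that meet \<open>A\<close> on the line through \<open>e\<close> in direction
  \<open>x\<close>. For a fixed \<open>H\<close>, only the members of \<open>H\<close> have to be avoided. The assignments for which
  this is possible and at which all members of \<open>H\<close> meet \<open>A\<close> lie in an intersection of projections
  of mutually algebraic sets that share a variable, and a definable subset of such an intersection
  is mutually algebraic. That the members of \<open>G - H\<close> miss \<open>A\<close> is a negated condition of the same
  kind.

  If \<open>x\<close> is the only variable of \<open>A\<close> (\<open>ma_comb_cyl_Diff_unary\<close>), the members of \<open>G\<close> in \<open>x\<close> alone are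
  first absorbed into \<open>A\<close>. When finitely many values of \<open>x\<close> remain, the projection is a finite union
  of instances \<open>x := c\<close>. When infinitely many remain, the projection is everything, because every
  other member of \<open>G\<close> forbids only finitely many values of \<open>x\<close>.

  The reduct statement follows by induction on formulas over the family: the only step besides
  closure under the logical operations is an atomic formula with permuted or repeated variables,
  for which mutually algebraic sets are shown to be stable under arbitrary renaming of variables.\<close>

section \<open>Uniform finiteness\<close>

definition at_most :: "nat \<Rightarrow> 'a set \<Rightarrow> bool" where
  "at_most K A \<longleftrightarrow> finite A \<and> card A \<le> K"

lemma at_most_subset: "at_most K A \<Longrightarrow> B \<subseteq> A \<Longrightarrow> at_most K B"
  unfolding at_most_def by (meson card_mono finite_subset le_trans)

lemma at_most_mono: "at_most K A \<Longrightarrow> K \<le> K' \<Longrightarrow> at_most K' A"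
  by (auto simp: at_most_def)

lemma at_most_image: "at_most K A \<Longrightarrow> at_most K (f ` A)"
  unfolding at_most_def by (meson card_image_le finite_imageI le_trans)

lemma at_most_Sigma:
  assumes "at_most K A" "\<And>p. p \<in> A \<Longrightarrow> at_most K' (B p)"
  shows "at_most (K * K') (Sigma A B)"
proof -
  have fin: "finite A" "\<And>p. p \<in> A \<Longrightarrow> finite (B p)"
    using assms by (auto simp: at_most_def)
  then have "card (Sigma A B) = (\<Sum>p\<in>A. card (B p))"
    by (simp add: card_SigmaI)
  also have "\<dots> \<le> card A * K'"
    using assms(2) sum_bounded_above[of A "\<lambda>p. card (B p)" K'] by (simp add: at_most_def)
  also have "\<dots> \<le> K * K'"
    using assms(1) by (simp add: at_most_def)
  finally show ?thesis
    using fin by (simp add: at_most_def)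
qed

lemma nths_eq_imp_nth_eq:
  assumes "length b = length c" "nths b Y = nths c Y" "i \<in> Y" "i < length b"
  shows "b ! i = c ! i"
  using assms
proof (induction b c arbitrary: Y i rule: list_induct2)
  case (Cons x xs y ys)
  \<comment> \<open>\<open>nths\<close> on the tail selects by the index set shifted down by one.\<close>
  have eq: "nths xs {j. Suc j \<in> Y} = nths ys {j. Suc j \<in> Y}"
    using Cons.prems(1) by (auto simp: nths_Cons split: if_splits)
  show ?case
  proof (cases i)
    case 0
    then show ?thesis using Cons.prems by (simp add: nths_Cons)
  next
    case (Suc j)
    then show ?thesis using Cons.IH[OF eq, of j] Cons.prems by simp
  qed
qed simp

lemma nths_singleton: "i < length b \<Longrightarrow> nths b {i} = [b ! i]"
proof (induction b arbitrary: i)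
  case (Cons x b)
  then show ?case
    by (cases i) (auto simp: nths_Cons)
qed simp

text \<open>A projection to more coordinates has smaller fibres, so singletons \<open>Y = {i}\<close> are the worst case.
  For \<open>n = 1\<close> there is no partition, and the right-hand side holds with bound 1, whence \<open>max K 1\<close>.\<close>

lemma mutually_algebraic_iff_nth:
  "mutually_algebraic A n B \<longleftrightarrow> 1 \<le> n \<and> B \<subseteq> cart_power A n \<and>
     (\<exists>K. \<forall>i<n. \<forall>a. at_most K {b \<in> B. b ! i = a})" (is "?L \<longleftrightarrow> ?R")
proof
  assume L: ?L
  then have n: "1 \<le> n" and B: "B \<subseteq> cart_power A n" by (auto simp: mutually_algebraic_def)
  then have len: "\<And>b. b \<in> B \<Longrightarrow> length b = n" by (auto simp: cart_power_def)
  from L obtain K where "\<forall>X Y. X \<union> Y = {..<n} \<longrightarrow> X \<inter> Y = {} \<longrightarrow> X \<noteq> {} \<longrightarrow> Y \<noteq> {} \<longrightarrow>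
        (\<forall>p. at_most K {b \<in> B. nths b Y = p})"
    unfolding mutually_algebraic_def at_most_def by (elim conjE exE)
  then have K: "at_most K {b \<in> B. nths b Y = p}"
    if "X \<union> Y = {..<n}" "X \<inter> Y = {}" "X \<noteq> {}" "Y \<noteq> {}" for X Y p
    using that by simp
  have "at_most (max K 1) {b \<in> B. b ! i = a}" if i: "i < n" for i a
  proof (cases "n = 1")
    case True
    have "b = [a]" if "b \<in> B" "b ! i = a" for b
      using len[OF that(1)] that(2) True i by (auto simp: length_Suc_conv)
    then have "{b \<in> B. b ! i = a} \<subseteq> {[a]}" by blast
    moreover have "at_most (max K 1) {[a]}" by (simp add: at_most_def)
    ultimately show ?thesis by (rule at_most_subset[rotated])
  next
    case False
    then have "(if i = 0 then 1 else 0) \<in> {..<n} - {i}" using n by auto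
    then have "at_most K {b \<in> B. nths b {i} = [a]}"
      using i by (intro K[of "{..<n} - {i}"]) auto
    moreover have "{b \<in> B. nths b {i} = [a]} = {b \<in> B. b ! i = a}"
      using i by (auto simp: nths_singleton len)
    ultimately show ?thesis using at_most_mono[of K _ "max K 1"] by simp
  qed
  then have "\<exists>K. \<forall>i<n. \<forall>a. at_most K {b \<in> B. b ! i = a}" by (intro exI[of _ "max K 1"]) simp
  then show ?R using n B by simp
next
  assume R: ?R
  then obtain K where K: "\<And>i a. i < n \<Longrightarrow> at_most K {b \<in> B. b ! i = a}" by blast
  have len: "\<And>b. b \<in> B \<Longrightarrow> length b = n" using R by (auto simp: cart_power_def)
  have "at_most K {b \<in> B. nths b Y = p}" if Y: "Y \<subseteq> {..<n}" "Y \<noteq> {}" for Y p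
  proof (cases "{b \<in> B. nths b Y = p} = {}")
    case True
    show ?thesis unfolding True by (simp add: at_most_def)
  next
    case False
    then obtain c where c: "c \<in> B" "nths c Y = p" by blast
    obtain i where i: "i \<in> Y" using Y by blast
    have "b ! i = c ! i" if "b \<in> B" "nths b Y = p" for b
      using nths_eq_imp_nth_eq[of b c Y i] that c i Y len by auto
    then have "{b \<in> B. nths b Y = p} \<subseteq> {b \<in> B. b ! i = c ! i}" by blast
    moreover have "i < n" using i Y by auto
    ultimately show ?thesis using at_most_subset[OF K] by simp
  qed
  then have *: "\<forall>X Y. X \<union> Y = {..<n} \<longrightarrow> X \<inter> Y = {} \<longrightarrow> X \<noteq> {} \<longrightarrow> Y \<noteq> {} \<longrightarrow>
      (\<forall>p. at_most K {b \<in> B. nths b Y = p})"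
    by (intro allI impI) (metis Un_upper2)
  show ?L
    unfolding mutually_algebraic_def at_most_def[symmetric]
    by (intro conjI exI[of _ K] * conjunct1[OF R] conjunct1[OF conjunct2[OF R]])
qed

section \<open>Cylindric set algebras\<close>

definition assignments :: "'a set \<Rightarrow> (nat \<Rightarrow> 'a) set" where
  "assignments U = {e. \<forall>x. e x \<in> U}"

lemma assignments_upd [simp]: "e \<in> assignments U \<Longrightarrow> a \<in> U \<Longrightarrow> e(x := a) \<in> assignments U"
  by (simp add: assignments_def)

lemma assignments_comp [simp]: "e \<in> assignments U \<Longrightarrow> e \<circ> \<rho> \<in> assignments U"
  by (simp add: assignments_def)

lemma assignments_apply [simp]: "e \<in> assignments U \<Longrightarrow> e x \<in> U"
  by (simp add: assignments_def)

definition cyl :: "'a set \<Rightarrow> nat \<Rightarrow> (nat \<Rightarrow> 'a) set \<Rightarrow> (nat \<Rightarrow> 'a) set" where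
  "cyl U x S = {e \<in> assignments U. \<exists>a\<in>U. e(x := a) \<in> S}"

definition supported :: "'a set \<Rightarrow> nat set \<Rightarrow> (nat \<Rightarrow> 'a) set \<Rightarrow> bool" where
  "supported U V S \<longleftrightarrow> (\<forall>e\<in>S. \<forall>e'\<in>assignments U. (\<forall>v\<in>V. e v = e' v) \<longrightarrow> e' \<in> S)"

lemma supportedD:
  "supported U V S \<Longrightarrow> e \<in> S \<Longrightarrow> e' \<in> assignments U \<Longrightarrow> (\<And>v. v \<in> V \<Longrightarrow> e v = e' v) \<Longrightarrow> e' \<in> S"
  unfolding supported_def by blast

lemma supported_Int: "supported U V S \<Longrightarrow> supported U W T \<Longrightarrow> supported U (V \<union> W) (S \<inter> T)"
  unfolding supported_def by blast

lemma supported_mono: "supported U V S \<Longrightarrow> V \<subseteq> W \<Longrightarrow> supported U W S"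
  unfolding supported_def by blast

lemma supported_Diff:
  assumes S: "supported U V S" "S \<subseteq> assignments U" and T: "supported U W T"
  shows "supported U (V \<union> W) (S - T)"
  unfolding supported_def
proof (intro ballI impI)
  fix e e' assume *: "e \<in> S - T" "e' \<in> assignments U" "\<forall>v\<in>V \<union> W. e v = e' v"
  then have "e' \<in> S" using supportedD[OF S(1), of e e'] by auto
  moreover have "e' \<notin> T" using * S(2) supportedD[OF T, of e' e] by auto
  ultimately show "e' \<in> S - T" by blast
qed

lemma supported_Union:
  assumes "\<And>S. S \<in> H \<Longrightarrow> supported U (V S) S"
  shows "supported U (\<Union>(V ` H)) (\<Union>H)"
  unfolding supported_def
proof (intro ballI impI)
  fix e e' assume *: "e \<in> \<Union>H" "e' \<in> assignments U" "\<forall>v\<in>\<Union>(V ` H). e v = e' v"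
  from *(1) obtain S where S: "S \<in> H" "e \<in> S" by blast
  have "e v = e' v" if "v \<in> V S" for v
    using *(3) S(1) that by blast
  then have "e' \<in> S" using supportedD[OF assms[OF S(1)] S(2) *(2)] by blast
  then show "e' \<in> \<Union>H" using S by blast
qed

lemma supported_cyl:
  assumes "supported U V S"
  shows "supported U (V - {x}) (cyl U x S)"
  unfolding supported_def
proof (intro ballI impI)
  fix e e' assume *: "e \<in> cyl U x S" "e' \<in> assignments U" "\<forall>v\<in>V - {x}. e v = e' v"
  then obtain a where a: "a \<in> U" "e(x := a) \<in> S" by (auto simp: cyl_def)
  have "e'(x := a) \<in> S"
    using * a by (intro supportedD[OF assms a(2)]) auto
  then show "e' \<in> cyl U x S" using * a by (auto simp: cyl_def)
qed

lemma cyl_UN: "cyl U x (\<Union>i\<in>I. f i) = (\<Union>i\<in>I. cyl U x (f i))"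
  by (auto simp: cyl_def)

text \<open>A condition that does not involve \<open>x\<close> moves out of the scope of \<open>\<exists>x\<close>.\<close>

lemma cyl_Int_unsupported:
  assumes P: "supported U V P" "x \<notin> V" "P \<subseteq> assignments U"
  shows "cyl U x (P \<inter> S) = P \<inter> cyl U x S"
proof -
  have "e(x := a) \<in> P \<longleftrightarrow> e \<in> P" if "e \<in> assignments U" "a \<in> U" for e a
    using supportedD[OF P(1), of e "e(x := a)"] supportedD[OF P(1), of "e(x := a)" e] that P(2)
    by (metis assignments_upd fun_upd_other)
  then show ?thesis using P(3) by (auto simp: cyl_def)
qed

text \<open>The elimination argument uses of definability only that it is a family of sets of assignments with
  the following closure properties. Points supply the parameters, and \<open>\<rho>\<close> is a renaming of
  variables that may identify some of them.\<close>

locale cylindric_algebra =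
  fixes U :: "'a set" and D :: "(nat \<Rightarrow> 'a) set set"
  assumes D_sub: "S \<in> D \<Longrightarrow> S \<subseteq> assignments U"
    and D_compl: "S \<in> D \<Longrightarrow> assignments U - S \<in> D"
    and D_Int: "S \<in> D \<Longrightarrow> T \<in> D \<Longrightarrow> S \<inter> T \<in> D"
    and D_cyl: "S \<in> D \<Longrightarrow> cyl U x S \<in> D"
    and D_diag: "{e \<in> assignments U. e x = e y} \<in> D"
    and D_point: "c \<in> U \<Longrightarrow> {e \<in> assignments U. e x = c} \<in> D"
    and D_rename: "S \<in> D \<Longrightarrow> {e \<in> assignments U. e \<circ> \<rho> \<in> S} \<in> D"
begin

abbreviation E :: "(nat \<Rightarrow> 'a) set" where "E \<equiv> assignments U"

lemma D_all: "E \<in> D"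
  using D_diag[of 0 0] by simp

lemma D_Diff: "S \<in> D \<Longrightarrow> T \<in> D \<Longrightarrow> S - T \<in> D"
  using D_Int[OF _ D_compl, of S T] D_sub[of S]
  by (metis Diff_Int_distrib Int_absorb2 Diff_Int2 Int_Diff)

lemma D_Diff_Union:
  assumes "finite H" "H \<subseteq> D" "S \<in> D"
  shows "S - \<Union>H \<in> D"
  using assms
proof (induction H)
  case (insert T H)
  have "S - \<Union>(insert T H) = (S - \<Union>H) - T" by blast
  then show ?case using insert D_Diff by simp
qed simp

section \<open>Mutually algebraic sets of assignments\<close>

text \<open>The tuple that an assignment \<open>e\<close> induces on a set of variables \<open>V\<close> is represented by
  \<open>restrict e V\<close>, which avoids a choice of an enumeration of \<open>V\<close>.\<close>

definition fibre :: "nat set \<Rightarrow> (nat \<Rightarrow> 'a) set \<Rightarrow> nat \<Rightarrow> 'a \<Rightarrow> (nat \<Rightarrow> 'a) set" where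
  "fibre V S v a = (\<lambda>e. restrict e V) ` {e \<in> S. e v = a}"

text \<open>The variable set \<open>V\<close> plays the part of the displayed tuple. It cannot be recovered from \<open>S\<close>, and the
  notion depends on it: when \<open>S\<close> is nonempty and the universe infinite, a dummy variable in \<open>V\<close>
  beside another variable makes a fibre over the latter infinite.\<close>

definition mut_alg :: "nat set \<Rightarrow> (nat \<Rightarrow> 'a) set \<Rightarrow> bool" where
  "mut_alg V S \<longleftrightarrow> S \<in> D \<and> finite V \<and> V \<noteq> {} \<and> supported U V S \<and>
     (\<exists>K. \<forall>v\<in>V. \<forall>a. at_most K (fibre V S v a))"

lemma mut_algD:
  assumes "mut_alg V S"
  shows "S \<in> D" "S \<subseteq> E" "finite V" "V \<noteq> {}" "supported U V S"
  using assms D_sub by (auto simp: mut_alg_def)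

lemma mut_alg_bound:
  assumes "mut_alg V S"
  obtains K where "\<And>v a. v \<in> V \<Longrightarrow> at_most K (fibre V S v a)"
  using assms unfolding mut_alg_def by blast

lemma mut_alg_subset:
  assumes S: "mut_alg V S" and T: "T \<in> D" "T \<subseteq> S" "supported U V T"
  shows "mut_alg V T"
proof -
  obtain K where K: "\<And>v a. v \<in> V \<Longrightarrow> at_most K (fibre V S v a)"
    using S by (rule mut_alg_bound) blast
  have "fibre V T v a \<subseteq> fibre V S v a" for v a
    using T(2) by (auto simp: fibre_def)
  then have "at_most K (fibre V T v a)" if "v \<in> V" for v a
    using that K at_most_subset by blast
  then show ?thesis using S T unfolding mut_alg_def by blast
qed

text \<open>A tuple of length one is determined by its only coordinate.\<close>

lemma mut_alg_unary:
  assumes "S \<in> D" "supported U {x} S"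
  shows "mut_alg {x} S"
proof -
  have "restrict e {x} = restrict (\<lambda>_. a) {x}" if "e x = a" for e :: "nat \<Rightarrow> 'a" and a
    using that by (auto simp: restrict_def)
  then have "fibre {x} S x a \<subseteq> {restrict (\<lambda>_. a) {x}}" for a
    by (auto simp: fibre_def)
  then have "at_most 1 (fibre {x} S x a)" for a
    by (rule at_most_subset[rotated]) (simp add: at_most_def)
  then show ?thesis using assms unfolding mut_alg_def by blast
qed

text \<open>Fixing the coordinate \<open>v\<close> leaves at most \<open>K\<close> restrictions to \<open>V\<close>; each of them fixes the common
  coordinate \<open>w\<close> and hence leaves at most \<open>K'\<close> restrictions to \<open>W\<close>.\<close>

lemma fibre_Int:
  assumes V: "\<And>a. at_most K (fibre V S v a)" and W: "\<And>a. at_most K' (fibre W T w a)"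
    and "w \<in> V"
  shows "at_most (K * K') (fibre (V \<union> W) (S \<inter> T) v a)"
proof -
  define glue where "glue = (\<lambda>(p :: nat \<Rightarrow> 'a, q). \<lambda>x. if x \<in> V then p x else q x)"
  have "fibre (V \<union> W) (S \<inter> T) v a \<subseteq>
      glue ` (SIGMA p : fibre V S v a. fibre W T w (p w))"
  proof
    fix r assume "r \<in> fibre (V \<union> W) (S \<inter> T) v a"
    then obtain e where e: "e \<in> S" "e \<in> T" "e v = a" "r = restrict e (V \<union> W)"
      by (auto simp: fibre_def)
    have "r = glue (restrict e V, restrict e W)"
      by (auto simp: e glue_def restrict_def)
    moreover have "restrict e V \<in> fibre V S v a"
      using e by (auto simp: fibre_def)
    moreover have "restrict e W \<in> fibre W T w (restrict e V w)"
      using e \<open>w \<in> V\<close> by (auto simp: fibre_def)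
    ultimately show "r \<in> glue ` (SIGMA p : fibre V S v a. fibre W T w (p w))"
      by blast
  qed
  moreover have "at_most (K * K') (glue ` (SIGMA p : fibre V S v a. fibre W T w (p w)))"
    by (intro at_most_image at_most_Sigma V W)
  ultimately show ?thesis by (rule at_most_subset[rotated])
qed

lemma mut_alg_Int:
  assumes S: "mut_alg V S" and T: "mut_alg W T" and VW: "V \<inter> W \<noteq> {}"
  shows "mut_alg (V \<union> W) (S \<inter> T)"
proof -
  obtain K where K: "\<And>v a. v \<in> V \<Longrightarrow> at_most K (fibre V S v a)"
    using S by (rule mut_alg_bound) blast
  obtain K' where K': "\<And>v a. v \<in> W \<Longrightarrow> at_most K' (fibre W T v a)"
    using T by (rule mut_alg_bound) blast
  obtain w where w: "w \<in> V" "w \<in> W" using VW by blast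
  have "at_most (K * K') (fibre (V \<union> W) (S \<inter> T) v a)" if "v \<in> V \<union> W" for v a
  proof (cases "v \<in> V")
    case True
    then show ?thesis using fibre_Int[OF K K', of v w a] w by blast
  next
    case False
    then have "v \<in> W" using that by blast
    then show ?thesis
      using fibre_Int[OF K' K, of v w a] w by (simp add: Un_commute Int_commute mult.commute)
  qed
  then show ?thesis
    using mut_algD[OF S] mut_algD[OF T] D_Int supported_Int unfolding mut_alg_def by blast
qed

lemma mut_alg_cyl:
  assumes S: "mut_alg V S" and V: "V - {x} \<noteq> {}"
  shows "mut_alg (V - {x}) (cyl U x S)"
proof -
  obtain K where K: "\<And>v a. v \<in> V \<Longrightarrow> at_most K (fibre V S v a)"
    using S by (rule mut_alg_bound) blast
  have sub: "fibre (V - {x}) (cyl U x S) v a \<subseteq> (\<lambda>p. restrict p (V - {x})) ` fibre V S v a"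
    if v: "v \<in> V - {x}" for v a
  proof
    fix r assume "r \<in> fibre (V - {x}) (cyl U x S) v a"
    then obtain e c where e: "e(x := c) \<in> S" "e v = a" "r = restrict e (V - {x})"
      by (auto simp: fibre_def cyl_def)
    have "r = restrict (restrict (e(x := c)) V) (V - {x})"
      by (auto simp: e restrict_def)
    moreover have "restrict (e(x := c)) V \<in> fibre V S v a"
      using e v by (auto simp: fibre_def)
    ultimately show "r \<in> (\<lambda>p. restrict p (V - {x})) ` fibre V S v a" by blast
  qed
  have "at_most K (fibre (V - {x}) (cyl U x S) v a)" if "v \<in> V - {x}" for v a
    by (rule at_most_subset[OF at_most_image[OF K] sub]) (use that in auto)
  then show ?thesis
    using mut_algD[OF S] D_cyl supported_cyl V unfolding mut_alg_def by blast
qed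

text \<open>If \<open>\<rho>\<close> identifies variables, the tuple on \<open>\<rho> ` V\<close> is still determined by the tuple that
  \<open>e \<circ> \<rho>\<close> induces on \<open>V\<close>.\<close>

lemma mut_alg_rename:
  assumes S: "mut_alg V S"
  shows "mut_alg (\<rho> ` V) {e \<in> E. e \<circ> \<rho> \<in> S}"
proof -
  obtain K where K: "\<And>v a. v \<in> V \<Longrightarrow> at_most K (fibre V S v a)"
    using S by (rule mut_alg_bound) blast
  define pull where "pull = (\<lambda>p :: nat \<Rightarrow> 'a. restrict (\<lambda>y. p (inv_into V \<rho> y)) (\<rho> ` V))"
  have sub: "fibre (\<rho> ` V) {e \<in> E. e \<circ> \<rho> \<in> S} (\<rho> v) a \<subseteq> pull ` fibre V S v a"
    if v: "v \<in> V" for v a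
  proof
    fix r assume "r \<in> fibre (\<rho> ` V) {e \<in> E. e \<circ> \<rho> \<in> S} (\<rho> v) a"
    then obtain e where e: "e \<circ> \<rho> \<in> S" "e (\<rho> v) = a" "r = restrict e (\<rho> ` V)"
      by (auto simp: fibre_def)
    have "r = pull (restrict (e \<circ> \<rho>) V)"
      unfolding e pull_def
      by (rule restrict_ext) (simp add: f_inv_into_f inv_into_into)
    moreover have "restrict (e \<circ> \<rho>) V \<in> fibre V S v a"
      using e by (auto simp: fibre_def)
    ultimately show "r \<in> pull ` fibre V S v a" by blast
  qed
  have "at_most K (fibre (\<rho> ` V) {e \<in> E. e \<circ> \<rho> \<in> S} y a)" if y: "y \<in> \<rho> ` V" for y a
  proof -
    obtain v where v: "v \<in> V" "y = \<rho> v" using y by blast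
    show ?thesis unfolding v(2) by (rule at_most_subset[OF at_most_image[OF K] sub]) (fact v)+
  qed
  moreover have "supported U (\<rho> ` V) {e \<in> E. e \<circ> \<rho> \<in> S}"
    unfolding supported_def
  proof (intro ballI impI)
    fix e e' assume *: "e \<in> {e \<in> E. e \<circ> \<rho> \<in> S}" "e' \<in> E" "\<forall>v\<in>\<rho> ` V. e v = e' v"
    have "(e \<circ> \<rho>) v = (e' \<circ> \<rho>) v" if "v \<in> V" for v
      using *(3) that by simp
    then have "e' \<circ> \<rho> \<in> S"
      using supportedD[OF mut_algD(5)[OF S], of "e \<circ> \<rho>" "e' \<circ> \<rho>"] *(1,2) by simp
    then show "e' \<in> {e \<in> E. e \<circ> \<rho> \<in> S}" using *(2) by simp
  qed
  ultimately show ?thesis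
    using mut_algD[OF S] D_rename unfolding mut_alg_def by blast
qed

lemma instance_eq_cyl:
  assumes "c \<in> U"
  shows "{e \<in> E. e(x := c) \<in> S} = cyl U x (S \<inter> {e \<in> E. e x = c})"
  using assms by (auto simp: cyl_def)

text \<open>Substituting \<open>c\<close> for \<open>x\<close> means intersecting with the unary set \<open>x = c\<close>, which shares the
  variable \<open>x\<close>, and projecting.\<close>

lemma mut_alg_instance:
  assumes S: "mut_alg V S" and x: "x \<in> V" "V - {x} \<noteq> {}" and c: "c \<in> U"
  shows "mut_alg (V - {x}) {e \<in> E. e(x := c) \<in> S}"
proof -
  have "mut_alg {x} {e \<in> E. e x = c}"
    by (rule mut_alg_unary) (auto simp: D_point c supported_def)
  then have "mut_alg (V \<union> {x}) (S \<inter> {e \<in> E. e x = c})"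
    using x by (intro mut_alg_Int[OF S]) auto
  moreover have "V \<union> {x} = V" using x by blast
  ultimately show ?thesis
    using mut_alg_cyl[of V _ x] x by (simp add: instance_eq_cyl[OF c])
qed

lemma mut_alg_all: "mut_alg {x} E"
  by (rule mut_alg_unary) (auto simp: D_all supported_def)

lemma mut_alg_diag: "mut_alg {x, y} {e \<in> E. e x = e y}"
proof -
  have "fibre {x, y} {e \<in> E. e x = e y} v a \<subseteq> {restrict (\<lambda>_. a) {x, y}}"
    if "v \<in> {x, y}" for v a
    using that by (auto simp: fibre_def restrict_def)
  then have "at_most 1 (fibre {x, y} {e \<in> E. e x = e y} v a)" if "v \<in> {x, y}" for v a
    by (rule at_most_subset[rotated]) (use that in \<open>simp_all add: at_most_def\<close>)
  moreover have "supported U {x, y} {e \<in> E. e x = e y}"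
    by (auto simp: supported_def)
  ultimately show ?thesis using D_diag unfolding mut_alg_def by blast
qed

text \<open>The line through \<open>e\<close> in direction \<open>x\<close> keeps some other coordinate \<open>w\<close> of \<open>V\<close> fixed.\<close>

lemma mut_alg_finite_section:
  assumes S: "mut_alg V S" and x: "x \<in> V" "V - {x} \<noteq> {}"
  shows "finite {a. e(x := a) \<in> S}"
proof -
  obtain w where w: "w \<in> V" "w \<noteq> x" using x by blast
  obtain K where K: "\<And>v a. v \<in> V \<Longrightarrow> at_most K (fibre V S v a)"
    using S by (rule mut_alg_bound) blast
  have "{a. e(x := a) \<in> S} \<subseteq> (\<lambda>p. p x) ` fibre V S w (e w)"
  proof
    fix a assume "a \<in> {a. e(x := a) \<in> S}"
    then have "restrict (e(x := a)) V \<in> fibre V S w (e w)"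
      using w by (auto simp: fibre_def)
    moreover have "a = restrict (e(x := a)) V x" using x by simp
    ultimately show "a \<in> (\<lambda>p. p x) ` fibre V S w (e w)" by blast
  qed
  then show ?thesis
    using K[OF w(1), of "e w"] by (auto simp: at_most_def intro: finite_subset)
qed

section \<open>Boolean combinations\<close>

text \<open>The semantic counterpart of \<open>MA_star\<close>, see \<open>MA_star_iff\<close>.\<close>

inductive_set ma_comb :: "(nat \<Rightarrow> 'a) set set" where
  ma_comb_mut_alg: "mut_alg V S \<Longrightarrow> S \<in> ma_comb"
| ma_comb_compl: "S \<in> ma_comb \<Longrightarrow> E - S \<in> ma_comb"
| ma_comb_Int: "S \<in> ma_comb \<Longrightarrow> T \<in> ma_comb \<Longrightarrow> S \<inter> T \<in> ma_comb"

lemma ma_comb_D: "S \<in> ma_comb \<Longrightarrow> S \<in> D"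
  by (induction rule: ma_comb.induct) (auto simp: mut_algD D_compl D_Int)

lemma ma_comb_sub: "S \<in> ma_comb \<Longrightarrow> S \<subseteq> E"
  using ma_comb_D D_sub by blast

lemma ma_comb_all: "E \<in> ma_comb"
  using mut_alg_all ma_comb_mut_alg by blast

lemma ma_comb_empty: "{} \<in> ma_comb"
  using ma_comb_compl[OF ma_comb_all] by simp

lemma ma_comb_Diff:
  assumes "S \<in> ma_comb" "T \<in> ma_comb"
  shows "S - T \<in> ma_comb"
proof -
  have "S - T = S \<inter> (E - T)" using ma_comb_sub[OF assms(1)] by blast
  then show ?thesis using assms ma_comb_Int ma_comb_compl by simp
qed

lemma ma_comb_Un:
  assumes "S \<in> ma_comb" "T \<in> ma_comb"
  shows "S \<union> T \<in> ma_comb"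
proof -
  have "S \<union> T = E - ((E - S) - T)" using assms ma_comb_sub by blast
  then show ?thesis using assms ma_comb_Diff ma_comb_compl by simp
qed

lemma ma_comb_UN: "finite I \<Longrightarrow> (\<And>i. i \<in> I \<Longrightarrow> f i \<in> ma_comb) \<Longrightarrow> (\<Union>i\<in>I. f i) \<in> ma_comb"
  by (induction rule: finite_induct) (simp_all add: ma_comb_empty ma_comb_Un)

lemma ma_comb_INT: "finite I \<Longrightarrow> (\<And>i. i \<in> I \<Longrightarrow> f i \<in> ma_comb) \<Longrightarrow> E \<inter> (\<Inter>i\<in>I. f i) \<in> ma_comb"
proof (induction rule: finite_induct)
  case (insert i I)
  have "E \<inter> (\<Inter>i\<in>insert i I. f i) = f i \<inter> (E \<inter> (\<Inter>i\<in>I. f i))" by auto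
  then show ?case using insert by (simp add: ma_comb_Int)
qed (simp add: ma_comb_all)

lemma ma_comb_rename: "S \<in> ma_comb \<Longrightarrow> {e \<in> E. e \<circ> \<rho> \<in> S} \<in> ma_comb"
proof (induction rule: ma_comb.induct)
  case (ma_comb_mut_alg V S)
  then show ?case using mut_alg_rename ma_comb.ma_comb_mut_alg by blast
next
  case (ma_comb_compl S)
  have eq: "{e \<in> E. e \<circ> \<rho> \<in> E - S} = E - {e \<in> E. e \<circ> \<rho> \<in> S}" by auto
  show ?case unfolding eq by (rule ma_comb.ma_comb_compl) (rule ma_comb_compl.IH)
next
  case (ma_comb_Int S T)
  have eq: "{e \<in> E. e \<circ> \<rho> \<in> S \<inter> T} = {e \<in> E. e \<circ> \<rho> \<in> S} \<inter> {e \<in> E. e \<circ> \<rho> \<in> T}" by auto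
  show ?case unfolding eq by (rule ma_comb.ma_comb_Int) (rule ma_comb_Int.IH)+
qed

lemma ma_comb_instance:
  assumes "S \<in> ma_comb" and c: "c \<in> U"
  shows "{e \<in> E. e(x := c) \<in> S} \<in> ma_comb"
  using assms(1)
proof (induction rule: ma_comb.induct)
  case (ma_comb_mut_alg V S)
  show ?case
  proof (cases "x \<in> V \<and> V - {x} \<noteq> {}")
    case True
    then show ?thesis using mut_alg_instance[OF ma_comb_mut_alg] c ma_comb.ma_comb_mut_alg by blast
  next
    case False
    define T where "T = {e \<in> E. e(x := c) \<in> S}"
    have "supported U (V - {x}) T"
      using supported_cyl[OF supported_Int[OF mut_algD(5)[OF ma_comb_mut_alg], of "{x}" "{e \<in> E. e x = c}"], of x]
      by (auto simp: T_def instance_eq_cyl[OF c] supported_def)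
    \<comment> \<open>Either \<open>V = {x}\<close> and the instance is trivial, or \<open>x \<notin> V\<close> and nothing changes.\<close>
    show ?thesis
    proof (cases "x \<in> V")
      case True
      then have "V - {x} = {}" using False by blast
      then have "supported U {} T" using \<open>supported U (V - {x}) T\<close> by metis
      then have "supported U {0} T" by (rule supported_mono) simp
      moreover have "T \<in> D"
        using mut_algD(1)[OF ma_comb_mut_alg] by (simp add: T_def instance_eq_cyl[OF c] D_cyl D_Int D_point c)
      ultimately show ?thesis using mut_alg_unary ma_comb.ma_comb_mut_alg T_def by blast
    next
      case False
      have "e(x := c) \<in> S \<longleftrightarrow> e \<in> S" if "e \<in> E" for e
        using supportedD[OF mut_algD(5)[OF ma_comb_mut_alg], of e "e(x := c)"]
          supportedD[OF mut_algD(5)[OF ma_comb_mut_alg], of "e(x := c)" e] that False c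
        by (metis assignments_upd fun_upd_other)
      then have "T = S" using mut_algD(2)[OF ma_comb_mut_alg] by (auto simp: T_def)
      then show ?thesis using ma_comb.ma_comb_mut_alg[OF ma_comb_mut_alg] unfolding T_def by metis
    qed
  qed
next
  case (ma_comb_compl S)
  have eq: "{e \<in> E. e(x := c) \<in> E - S} = E - {e \<in> E. e(x := c) \<in> S}" using c by auto
  show ?case unfolding eq by (rule ma_comb.ma_comb_compl) (rule ma_comb_compl.IH)
next
  case (ma_comb_Int S T)
  have eq: "{e \<in> E. e(x := c) \<in> S \<inter> T} = {e \<in> E. e(x := c) \<in> S} \<inter> {e \<in> E. e(x := c) \<in> T}" by auto
  show ?case unfolding eq by (rule ma_comb.ma_comb_Int) (rule ma_comb_Int.IH)+
qed

text \<open>A quantifier over a finite set of values is a finite disjunction of instances.\<close>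

lemma ma_comb_cyl_finite:
  assumes S: "S \<in> ma_comb" and fin: "finite ((\<lambda>e. e x) ` S)"
  shows "cyl U x S \<in> ma_comb"
proof -
  have "cyl U x S = (\<Union>c\<in>(\<lambda>e. e x) ` S. {e \<in> E. e(x := c) \<in> S})"
    using ma_comb_sub[OF S] by (auto simp: cyl_def image_iff intro!: bexI)
  moreover have "\<dots> \<in> ma_comb"
    using fin ma_comb_sub[OF S] by (intro ma_comb_UN ma_comb_instance[OF S]) auto
  ultimately show ?thesis by simp
qed

section \<open>Closure under projection\<close>

text \<open>The members of \<open>G\<close> split into the unary ones, which are subtracted from \<open>A\<close>, and the others,
  each of which excludes only finitely many values of \<open>x\<close> at a given assignment. So either only
  finitely many values of \<open>x\<close> are left in total, or some value is left at every assignment.\<close>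

lemma ma_comb_cyl_Diff_unary:
  assumes A: "mut_alg {x} A"
    and G: "finite G" "\<And>B. B \<in> G \<Longrightarrow> mut_alg (V B) B" "\<And>B. B \<in> G \<Longrightarrow> x \<in> V B"
  shows "cyl U x (A - \<Union>G) \<in> ma_comb"
proof -
  define G1 where "G1 = {B \<in> G. V B = {x}}"
  define A1 where "A1 = A - \<Union>G1"
  have fin: "finite G1" using G(1) by (simp add: G1_def)
  have "supported U (V B) B" if "B \<in> G1" for B
    using that mut_algD(5)[OF G(2), of B] unfolding G1_def by blast
  then have "supported U ({x} \<union> \<Union>(V ` G1)) A1"
    unfolding A1_def by (intro supported_Diff supported_Union mut_algD(5)[OF A] mut_algD(2)[OF A])
  then have A1: "supported U {x} A1"
    by (rule supported_mono) (auto simp: G1_def)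
  have AG: "A - \<Union>G \<in> ma_comb"
    using ma_comb_Diff[OF ma_comb_mut_alg[OF A] ma_comb_UN[OF G(1), of id]] ma_comb_mut_alg[OF G(2)] by simp
  show ?thesis
  proof (cases "finite ((\<lambda>e. e x) ` A1)")
    case True
    then have "finite ((\<lambda>e. e x) ` (A - \<Union>G))"
      by (rule finite_subset[rotated]) (auto simp: A1_def G1_def)
    then show ?thesis using AG ma_comb_cyl_finite by blast
  next
    case False
    have "e \<in> cyl U x (A - \<Union>G)" if e: "e \<in> E" for e
    proof -
      have "finite (\<Union>B\<in>G - G1. {a. e(x := a) \<in> B})"
      proof (intro finite_UN_I)
        fix B assume "B \<in> G - G1"
        then show "finite {a. e(x := a) \<in> B}"
          using G by (intro mut_alg_finite_section[of "V B"]) (auto simp: G1_def)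
      qed (simp add: G(1))
      then obtain a where a: "a \<in> (\<lambda>e. e x) ` A1" "a \<notin> (\<Union>B\<in>G - G1. {a. e(x := a) \<in> B})"
        using False by (meson finite_subset subsetI)
      then obtain e' where e': "e' \<in> A1" "e' x = a" by blast
      then have aU: "a \<in> U" using mut_algD(2)[OF A] by (auto simp: A1_def)
      then have "e(x := a) \<in> A1"
        using e e' by (intro supportedD[OF A1 e'(1)]) auto
      then have "e(x := a) \<in> A - \<Union>G" using a(2) by (auto simp: A1_def)
      then show ?thesis using e aU by (auto simp: cyl_def)
    qed
    then have "cyl U x (A - \<Union>G) = E" by (auto simp: cyl_def)
    then show ?thesis by (simp add: ma_comb_all)
  qed
qed

text \<open>The set \<open>H\<close> of those \<open>B \<in> G\<close> for which \<open>e \<in> cyl U x (A \<inter> B)\<close> records which members of \<open>G\<close> are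
  relevant at \<open>e\<close>. Given \<open>H\<close>, membership of \<open>e\<close> in the projection is the condition
  \<open>e \<in> cyl U x (A - \<Union>H)\<close>. Together with the positive part \<open>Z H\<close> of the description of \<open>H\<close>, this
  defines a subset of \<open>Z H\<close>, and \<open>Z H\<close> is mutually algebraic because the projections it
  intersects share the variables of \<open>A\<close> other than \<open>x\<close>. The negative part of the description of \<open>H\<close>
  subtracts further mutually algebraic sets.\<close>

lemma ma_comb_cyl_Diff_nonunary:
  assumes A: "mut_alg V0 A" and V0: "x \<in> V0" "V0 - {x} \<noteq> {}"
    and G: "finite G" "\<And>B. B \<in> G \<Longrightarrow> mut_alg (V B) B" "\<And>B. B \<in> G \<Longrightarrow> x \<in> V B"
  shows "cyl U x (A - \<Union>G) \<in> ma_comb"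
proof -
  define Z where "Z H = cyl U x A \<inter> (\<Inter>B\<in>H. cyl U x (A \<inter> B))" for H
  define W where "W H = V0 \<union> \<Union>(V ` H)" for H
  have AB: "mut_alg ((V0 \<union> V B) - {x}) (cyl U x (A \<inter> B))" if "B \<in> G" for B
    using A V0 G(2,3)[OF that] by (intro mut_alg_cyl mut_alg_Int) auto
  have Z: "mut_alg (W H - {x}) (Z H)" if "H \<subseteq> G" for H
    using finite_subset[OF that G(1)] that
  proof (induction H rule: finite_induct)
    case empty
    then show ?case using mut_alg_cyl[OF A V0(2)] by (simp add: Z_def W_def)
  next
    case (insert B H)
    have "mut_alg ((W H - {x}) \<union> ((V0 \<union> V B) - {x})) (Z H \<inter> cyl U x (A \<inter> B))"
      using insert V0 AB by (intro mut_alg_Int) (auto simp: W_def)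
    moreover have "Z H \<inter> cyl U x (A \<inter> B) = Z (insert B H)" by (auto simp: Z_def)
    moreover have "(W H - {x}) \<union> ((V0 \<union> V B) - {x}) = W (insert B H) - {x}"
      by (auto simp: W_def)
    ultimately show ?case by simp
  qed
  have piece: "cyl U x (A - \<Union>H) \<inter> Z H \<in> ma_comb" if H: "H \<subseteq> G" for H
  proof -
    have fin: "finite H" using H G(1) by (rule finite_subset)
    have "supported U (V B) B" if "B \<in> H" for B
      using that H mut_algD(5)[OF G(2)] by blast
    then have "supported U (W H) (A - \<Union>H)"
      unfolding W_def by (intro supported_Diff supported_Union mut_algD(5)[OF A] mut_algD(2)[OF A])
    then have "supported U ((W H - {x}) \<union> (W H - {x})) (cyl U x (A - \<Union>H) \<inter> Z H)"
      by (intro supported_Int supported_cyl mut_algD(5)[OF Z[OF H]])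
    moreover have "A - \<Union>H \<in> D"
      using fin H G(2) mut_algD(1) A by (intro D_Diff_Union) blast+
    then have "cyl U x (A - \<Union>H) \<inter> Z H \<in> D"
      by (intro D_Int D_cyl mut_algD(1)[OF Z[OF H]])
    ultimately have "mut_alg (W H - {x}) (cyl U x (A - \<Union>H) \<inter> Z H)"
      by (intro mut_alg_subset[OF Z[OF H]]) auto
    then show ?thesis by (rule ma_comb_mut_alg)
  qed
  have "cyl U x (A - \<Union>G) =
      (\<Union>H\<in>Pow G. cyl U x (A - \<Union>H) \<inter> Z H - (\<Union>B\<in>G - H. cyl U x (A \<inter> B)))" (is "?l = ?r")
  proof
    show "?l \<subseteq> ?r"
    proof
      fix e assume e: "e \<in> ?l"
      define H where "H = {B \<in> G. e \<in> cyl U x (A \<inter> B)}"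
      have "e \<in> cyl U x (A - \<Union>H) \<inter> Z H - (\<Union>B\<in>G - H. cyl U x (A \<inter> B))"
        using e by (auto simp: H_def Z_def cyl_def)
      moreover have "H \<in> Pow G" by (auto simp: H_def)
      ultimately show "e \<in> ?r" by blast
    qed
    show "?r \<subseteq> ?l"
    proof
      fix e assume "e \<in> ?r"
      then obtain H where H: "e \<in> cyl U x (A - \<Union>H)" "\<forall>B\<in>G - H. e \<notin> cyl U x (A \<inter> B)" by blast
      then obtain a where a: "e \<in> E" "a \<in> U" "e(x := a) \<in> A - \<Union>H" by (auto simp: cyl_def)
      then have "e(x := a) \<notin> B" if "B \<in> G" for B
        using that H(2) by (cases "B \<in> H") (auto simp: cyl_def)
      then show "e \<in> ?l" using a by (auto simp: cyl_def)
    qed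
  qed
  also have "\<dots> \<in> ma_comb"
    using G(1) piece ma_comb_mut_alg[OF AB] by (intro ma_comb_UN ma_comb_Diff) auto
  finally show ?thesis .
qed

text \<open>A subset of \<open>E\<close> is a boolean combination, relative to \<open>E\<close>, of a finite family \<open>F\<close> exactly if the members of \<open>F\<close> cannot separate a
  point inside it from a point outside. This replaces disjunctive normal forms.\<close>

definition determines :: "(nat \<Rightarrow> 'a) set set \<Rightarrow> (nat \<Rightarrow> 'a) set \<Rightarrow> bool" where
  "determines F S \<longleftrightarrow>
     (\<forall>e\<in>E. \<forall>e'\<in>E. {A \<in> F. e \<in> A} = {A \<in> F. e' \<in> A} \<longrightarrow> e \<in> S \<longrightarrow> e' \<in> S)"

lemma determinesD:
  assumes "determines F S" "e \<in> E" "e' \<in> E" "{A \<in> F. e \<in> A} = {A \<in> F. e' \<in> A}" "e \<in> S"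
  shows "e' \<in> S"
  by (rule assms(1)[unfolded determines_def, rule_format]) (fact assms)+

lemma determines_mono:
  assumes "determines F S" "F \<subseteq> F'"
  shows "determines F' S"
  unfolding determines_def
proof (intro ballI impI)
  fix e e' assume *: "e \<in> E" "e' \<in> E" "{A \<in> F'. e \<in> A} = {A \<in> F'. e' \<in> A}" "e \<in> S"
  have "{A \<in> F. e \<in> A} = {A \<in> F. e' \<in> A}"
    using *(3) assms(2) by blast
  then show "e' \<in> S" by (rule determinesD[OF assms(1) *(1,2) _ *(4)])
qed

lemma ma_comb_finitely_determined:
  assumes "S \<in> ma_comb"
  shows "\<exists>F. finite F \<and> (\<forall>A\<in>F. \<exists>V. mut_alg V A) \<and> determines F S"
  using assms
proof (induction rule: ma_comb.induct)
  case (ma_comb_mut_alg V S)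
  have "determines {S} S" unfolding determines_def by blast
  then show ?case using ma_comb_mut_alg by (intro exI[of _ "{S}"]) auto
next
  case (ma_comb_compl S)
  then obtain F where F: "finite F" "\<forall>A\<in>F. \<exists>V. mut_alg V A" "determines F S" by (elim exE conjE)
  have "determines F (E - S)"
    unfolding determines_def
  proof (intro ballI impI)
    fix e e' assume "e \<in> E" "e' \<in> E" "{A \<in> F. e \<in> A} = {A \<in> F. e' \<in> A}" "e \<in> E - S"
    then show "e' \<in> E - S" using determinesD[OF F(3), of e' e] by auto
  qed
  then show ?case using F by (intro exI[of _ F]) simp
next
  case (ma_comb_Int S T)
  from ma_comb_Int.IH(1) obtain F where F: "finite F" "\<forall>A\<in>F. \<exists>V. mut_alg V A" "determines F S"
    by (elim exE conjE)
  from ma_comb_Int.IH(2) obtain F' where F': "finite F'" "\<forall>A\<in>F'. \<exists>V. mut_alg V A" "determines F' T"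
    by (elim exE conjE)
  have "determines (F \<union> F') S" "determines (F \<union> F') T"
    using F(3) F'(3) by (auto intro: determines_mono)
  then have "determines (F \<union> F') (S \<inter> T)"
    using determinesD unfolding determines_def[of _ "S \<inter> T"] by (intro ballI impI IntI) blast+
  then show ?case
    using F(1,2) F'(1,2) by (intro exI[of _ "F \<union> F'"]) auto
qed

text \<open>With the factor \<open>P\<close> that does not involve \<open>x\<close> pulled out, the positive generators that remain are
  intersected to one mutually algebraic set \<open>A\<close>; including the trivial condition on \<open>x\<close> keeps
  \<open>A\<close> meaningful when there are none.\<close>

lemma ma_comb_cyl_cell:
  assumes F: "finite F" "\<And>A. A \<in> F \<Longrightarrow> mut_alg (V A) A" and t: "t \<subseteq> F"
  shows "cyl U x {e \<in> E. {A \<in> F. e \<in> A} = t} \<in> ma_comb"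
proof -
  define P where "P = E \<inter> \<Inter>{A \<in> t. x \<notin> V A} - \<Union>{B \<in> F - t. x \<notin> V B}"
  define A where "A = E \<inter> \<Inter>{A \<in> t. x \<in> V A}"
  define G where "G = {B \<in> F - t. x \<in> V B}"
  define VP where "VP = \<Union>(V ` {A \<in> F. x \<notin> V A})"
  have fin: "finite t" using t F(1) by (rule finite_subset)
  have cell: "{e \<in> E. {A \<in> F. e \<in> A} = t} = P \<inter> (A - \<Union>G)"
    using t by (auto simp: P_def A_def G_def)
  have "supported U VP P"
    unfolding supported_def
  proof (intro ballI impI)
    fix e e' assume *: "e \<in> P" "e' \<in> E" "\<forall>v\<in>VP. e v = e' v"
    have e: "e \<in> E" using * by (auto simp: P_def)
    have "e \<in> B \<longleftrightarrow> e' \<in> B" if "B \<in> F" "x \<notin> V B" for B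
    proof -
      have "e v = e' v" if "v \<in> V B" for v
        using * \<open>B \<in> F\<close> \<open>x \<notin> V B\<close> that by (auto simp: VP_def)
      then show ?thesis
        using supportedD[OF mut_algD(5)[OF F(2)[OF \<open>B \<in> F\<close>]], of e e']
          supportedD[OF mut_algD(5)[OF F(2)[OF \<open>B \<in> F\<close>]], of e' e] e *(2) by auto
    qed
    then show "e' \<in> P" using * t by (auto simp: P_def)
  qed
  then have split: "cyl U x (P \<inter> (A - \<Union>G)) = P \<inter> cyl U x (A - \<Union>G)"
    by (rule cyl_Int_unsupported) (auto simp: VP_def P_def)
  have "P \<in> ma_comb"
    unfolding P_def using fin F(1) t ma_comb_mut_alg[OF F(2)]
    by (intro ma_comb_Diff ma_comb_INT[of _ id, simplified] ma_comb_UN[of _ id, simplified]) auto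
  moreover have "cyl U x (A - \<Union>G) \<in> ma_comb"
  proof -
    \<comment> \<open>Starting from \<open>{x}\<close> and \<open>E\<close>, each new generator shares at least \<open>x\<close>.\<close>
    have "mut_alg ({x} \<union> \<Union>(V ` s)) (E \<inter> \<Inter>s)" if "s \<subseteq> {A \<in> t. x \<in> V A}" for s
      using finite_subset[OF that finite_subset[OF _ fin]] that
    proof (induction s rule: infinite_finite_induct)
      case empty
      then show ?case using mut_alg_all by simp
    next
      case (insert B s)
      have "mut_alg (({x} \<union> \<Union>(V ` s)) \<union> V B) ((E \<inter> \<Inter>s) \<inter> B)"
        using insert F(2)[of B] t by (intro mut_alg_Int[OF insert.IH]) auto
      moreover have "(E \<inter> \<Inter>s) \<inter> B = E \<inter> \<Inter>(insert B s)" by blast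
      moreover have "({x} \<union> \<Union>(V ` s)) \<union> V B = {x} \<union> \<Union>(V ` insert B s)" by blast
      ultimately show ?case by simp
    qed simp
    then obtain V0 where V0: "mut_alg V0 A" "x \<in> V0"
      unfolding A_def by blast
    show ?thesis
    proof (cases "V0 = {x}")
      case True
      then show ?thesis
        using V0 F by (intro ma_comb_cyl_Diff_unary[of _ _ _ V]) (auto simp: G_def)
    next
      case False
      then show ?thesis
        using V0 F by (intro ma_comb_cyl_Diff_nonunary[of V0 _ _ _ V]) (auto simp: G_def)
    qed
  qed
  ultimately show ?thesis
    unfolding cell split by (rule ma_comb_Int)
qed

lemma ma_comb_cyl:
  assumes "S \<in> ma_comb"
  shows "cyl U x S \<in> ma_comb"
proof -
  obtain F where F: "finite F" "\<forall>A\<in>F. \<exists>V. mut_alg V A" and det: "determines F S"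
    using ma_comb_finitely_determined[OF assms] by (elim exE conjE)
  obtain V where V: "\<And>A. A \<in> F \<Longrightarrow> mut_alg (V A) A" using bchoice[OF F(2)] by blast
  define T where "T = (\<lambda>e. {A \<in> F. e \<in> A}) ` S"
  have T: "T \<subseteq> Pow F" by (auto simp: T_def)
  then have "finite T" using F(1) by (simp add: finite_subset)
  have "S = (\<Union>t\<in>T. {e \<in> E. {A \<in> F. e \<in> A} = t})" (is "_ = ?r")
  proof
    show "S \<subseteq> ?r" using ma_comb_sub[OF assms] by (auto simp: T_def)
    show "?r \<subseteq> S"
    proof
      fix e' assume "e' \<in> ?r"
      then obtain e where e: "e \<in> S" "e' \<in> E" "{A \<in> F. e' \<in> A} = {A \<in> F. e \<in> A}"
        unfolding T_def by auto
      have "e \<in> E" using e(1) ma_comb_sub[OF assms] by blast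
      then show "e' \<in> S" using determinesD[OF det, of e e'] e by simp
    qed
  qed
  then have "cyl U x S = cyl U x ?r" by (rule arg_cong)
  also have "\<dots> = (\<Union>t\<in>T. cyl U x {e \<in> E. {A \<in> F. e \<in> A} = t})" by (rule cyl_UN)
  also have "\<dots> \<in> ma_comb"
  proof (rule ma_comb_UN[OF \<open>finite T\<close>])
    fix t assume "t \<in> T"
    then show "cyl U x {e \<in> E. {A \<in> F. e \<in> A} = t} \<in> ma_comb"
      using T by (intro ma_comb_cyl_cell[OF F(1), of V] V) blast+
  qed
  finally show ?thesis .
qed

end

section \<open>Definable sets of assignments\<close>

definition truth_set :: "('f, 'r, 'a) fo_struct \<Rightarrow> ('f, 'r) form \<Rightarrow> (nat \<Rightarrow> 'a) set" where
  "truth_set N \<phi> = {e \<in> assignments (univ N). sat N e \<phi>}"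

lemma truth_set_Neg: "truth_set N (Neg \<phi>) = assignments (univ N) - truth_set N \<phi>"
  and truth_set_Conj: "truth_set N (Conj \<phi> \<psi>) = truth_set N \<phi> \<inter> truth_set N \<psi>"
  and truth_set_Exi: "truth_set N (Exi x \<phi>) = cyl (univ N) x (truth_set N \<phi>)"
  by (auto simp: truth_set_def cyl_def)

lemma truth_set_sub: "truth_set N \<phi> \<subseteq> assignments (univ N)"
  by (auto simp: truth_set_def)

lemma valid_in_Iff: "valid_in N (Iff \<phi> \<psi>) \<longleftrightarrow> truth_set N \<phi> = truth_set N \<psi>"
proof -
  have "valid_in N (Iff \<phi> \<psi>) \<longleftrightarrow> (\<forall>e\<in>assignments (univ N). sat N e \<phi> \<longleftrightarrow> sat N e \<psi>)"
    unfolding valid_in_def assignments_def Ball_def mem_Collect_eq sat.simps by metis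
  also have "\<dots> \<longleftrightarrow> truth_set N \<phi> = truth_set N \<psi>"
    unfolding truth_set_def by blast
  finally show ?thesis .
qed

lemma solutions_eq: "solutions N \<phi> zs = (\<lambda>e. map e zs) ` truth_set N \<phi>"
  unfolding solutions_def truth_set_def assignments_def by blast

lemma eval_trm_cong: "(\<And>x. x \<in> trm_vars t \<Longrightarrow> e x = e' x) \<Longrightarrow> eval_trm N e t = eval_trm N e' t"
proof (induction t)
  case (App f ts)
  have "map (eval_trm N e) ts = map (eval_trm N e') ts"
    using App by (intro map_cong refl) auto
  then show ?case by (simp del: map_eq_conv)
qed simp

lemma sat_cong: "(\<And>x. x \<in> free_vars \<phi> \<Longrightarrow> e x = e' x) \<Longrightarrow> sat N e \<phi> \<longleftrightarrow> sat N e' \<phi>"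
proof (induction \<phi> arbitrary: e e')
  case (Equal s t)
  have "eval_trm N e s = eval_trm N e' s" "eval_trm N e t = eval_trm N e' t"
    using Equal by (auto intro!: eval_trm_cong)
  then show ?case by simp
next
  case (Rel r ts)
  have "map (eval_trm N e) ts = map (eval_trm N e') ts"
    using Rel by (intro map_cong refl eval_trm_cong) auto
  then show ?case by (simp del: map_eq_conv)
next
  case (Neg \<phi>)
  have "sat N e \<phi> \<longleftrightarrow> sat N e' \<phi>" using Neg.prems by (intro Neg.IH) simp
  then show ?case by simp
next
  case (Conj \<phi> \<psi>)
  have "sat N e \<phi> \<longleftrightarrow> sat N e' \<phi>" "sat N e \<psi> \<longleftrightarrow> sat N e' \<psi>"
    using Conj.prems by (auto intro!: Conj.IH)
  then show ?case by simp
next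
  case (Exi x \<phi>)
  have "sat N (e(x := a)) \<phi> \<longleftrightarrow> sat N (e'(x := a)) \<phi>" for a
    using Exi.prems by (intro Exi.IH) auto
  then show ?case by simp
qed

lemma supported_truth_set:
  assumes "free_vars \<phi> \<subseteq> V"
  shows "supported (univ N) V (truth_set N \<phi>)"
  unfolding supported_def
proof (intro ballI impI)
  fix e e' assume *: "e \<in> truth_set N \<phi>" "e' \<in> assignments (univ N)" "\<forall>v\<in>V. e v = e' v"
  have "sat N e \<phi> \<longleftrightarrow> sat N e' \<phi>" using *(3) assms by (intro sat_cong) blast
  then show "e' \<in> truth_set N \<phi>" using * by (simp add: truth_set_def)
qed

text \<open>Being supported by \<open>V\<close> is a semantic property, whereas \<open>displays\<close> constrains the free variables.
  Quantifying out the superfluous free variables reconciles the two without changing the truth set.\<close>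

lemma formula_for_support:
  assumes \<phi>: "is_formula L \<phi>" and V: "supported (univ N) V (truth_set N \<phi>)"
  shows "\<exists>\<phi>'. is_formula L \<phi>' \<and> free_vars \<phi>' \<subseteq> V \<and> truth_set N \<phi>' = truth_set N \<phi>"
proof -
  have "finite (free_vars \<phi> - V)" by (simp add: finite_free_vars)
  then obtain xs where xs: "set xs = free_vars \<phi> - V" using finite_list by blast
  have drop: "truth_set N (foldr Exi ys \<phi>) = truth_set N \<phi>" if "set ys \<inter> V = {}" for ys
    using that
  proof (induction ys)
    case (Cons y ys)
    then have "truth_set N (foldr Exi (y # ys) \<phi>) =
        cyl (univ N) y (truth_set N \<phi> \<inter> assignments (univ N))"
      using truth_set_sub[of N \<phi>] by (simp add: truth_set_Exi Int_absorb2)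
    also have "\<dots> = truth_set N \<phi> \<inter> cyl (univ N) y (assignments (univ N))"
      using Cons.prems by (intro cyl_Int_unsupported[OF V] truth_set_sub) auto
    also have "\<dots> = truth_set N \<phi>"
    proof -
      have "e \<in> cyl (univ N) y (assignments (univ N))" if "e \<in> assignments (univ N)" for e
        unfolding cyl_def using that by (intro CollectI conjI bexI[of _ "e y"]) simp_all
      then show ?thesis using truth_set_sub[of N \<phi>] by blast
    qed
    finally show ?case .
  qed simp
  have "is_formula L (foldr Exi ys \<phi>)" for ys
    using \<phi> by (induction ys) auto
  moreover have "free_vars (foldr Exi ys \<phi>) = free_vars \<phi> - set ys" for ys
    by (induction ys) auto
  ultimately show ?thesis
    using xs drop[of xs] by (intro exI[of _ "foldr Exi xs \<phi>"]) auto
qed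

fun rename_trm :: "(nat \<Rightarrow> nat) \<Rightarrow> 'f trm \<Rightarrow> 'f trm" where
  "rename_trm \<rho> (Var x) = Var (\<rho> x)"
| "rename_trm \<rho> (App f ts) = App f (map (rename_trm \<rho>) ts)"

lemma eval_rename_trm: "eval_trm N e (rename_trm \<rho> t) = eval_trm N (\<lambda>x. e (\<rho> x)) t"
proof (induction t)
  case (App f ts)
  then have "map (\<lambda>t. eval_trm N e (rename_trm \<rho> t)) ts = map (eval_trm N (\<lambda>x. e (\<rho> x))) ts"
    by simp
  then show ?case by (simp add: comp_def del: map_eq_conv)
qed simp

lemma is_term_rename_trm: "is_term L t \<Longrightarrow> is_term L (rename_trm \<rho> t)"
  by (induction t) auto

text \<open>Bound variables have to be kept away from the images of the free ones, so the renamed formula is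
  built with a fresh bound variable at each quantifier instead of by a fixed substitution function.\<close>

lemma ex_renamed_formula:
  assumes "is_formula L \<phi>"
  shows "\<exists>\<phi>'. is_formula L \<phi>' \<and> (\<forall>e. sat N e \<phi>' \<longleftrightarrow> sat N (\<lambda>x. e (\<rho> x)) \<phi>)"
  using assms
proof (induction \<phi> arbitrary: \<rho>)
  case (Equal s t)
  then show ?case
    by (intro exI[of _ "Equal (rename_trm \<rho> s) (rename_trm \<rho> t)"])
      (simp add: is_term_rename_trm eval_rename_trm comp_def)
next
  case (Rel r ts)
  then show ?case
    by (intro exI[of _ "Rel r (map (rename_trm \<rho>) ts)"])
      (simp add: is_term_rename_trm eval_rename_trm comp_def)
next
  case (Neg \<phi>)
  from Neg.IH[of \<rho>] Neg.prems obtain \<phi>' where "is_formula L \<phi>'" "\<forall>e. sat N e \<phi>' \<longleftrightarrow> sat N (\<lambda>x. e (\<rho> x)) \<phi>" by auto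
  then show ?case by (intro exI[of _ "Neg \<phi>'"]) simp
next
  case (Conj \<phi> \<psi>)
  from Conj.IH(1)[of \<rho>] Conj.prems obtain \<phi>' where
    "is_formula L \<phi>'" "\<forall>e. sat N e \<phi>' \<longleftrightarrow> sat N (\<lambda>x. e (\<rho> x)) \<phi>" by auto
  moreover from Conj.IH(2)[of \<rho>] Conj.prems obtain \<psi>' where
    "is_formula L \<psi>'" "\<forall>e. sat N e \<psi>' \<longleftrightarrow> sat N (\<lambda>x. e (\<rho> x)) \<psi>" by auto
  ultimately show ?case by (intro exI[of _ "Conj \<phi>' \<psi>'"]) simp
next
  case (Exi x \<phi>)
  obtain y where y: "y \<notin> \<rho> ` free_vars \<phi>"
    using ex_new_if_finite[OF infinite_UNIV_nat finite_imageI[OF finite_free_vars]] by blast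
  from Exi.IH[of "\<rho>(x := y)"] Exi.prems obtain \<phi>' where
    \<phi>': "is_formula L \<phi>'" "\<And>e. sat N e \<phi>' \<longleftrightarrow> sat N (\<lambda>z. e ((\<rho>(x := y)) z)) \<phi>" by auto
  have "sat N (\<lambda>z. (e(y := a)) ((\<rho>(x := y)) z)) \<phi> \<longleftrightarrow> sat N ((\<lambda>x. e (\<rho> x))(x := a)) \<phi>" for e a
    using y by (intro sat_cong) auto
  then show ?case
    using \<phi>' by (intro exI[of _ "Exi y \<phi>'"]) simp
qed

section \<open>The structure carried by the mutually algebraic formulas\<close>

lemma ex_map_eq:
  assumes "length zs = length ys" "distinct zs"
  shows "\<exists>\<rho>. map \<rho> zs = ys"
  using assms
proof (induction zs ys rule: list_induct2)
  case (Cons z zs y ys)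
  then obtain \<rho> where "map \<rho> zs = ys" by auto
  then show ?case using Cons.prems by (intro exI[of _ "\<rho>(z := y)"]) auto
qed simp

lemma map_mem_image_iff:
  assumes "supported U (set zs) S" "e \<in> assignments U" "S \<subseteq> assignments U"
  shows "map e zs \<in> (\<lambda>e. map e zs) ` S \<longleftrightarrow> e \<in> S"
proof
  assume "map e zs \<in> (\<lambda>e. map e zs) ` S"
  then obtain e' where "e' \<in> S" "map e' zs = map e zs" by (metis imageE)
  then show "e \<in> S" using supportedD[OF assms(1) _ assms(2), of e'] by simp
qed blast

locale fo_model =
  fixes L :: "('f, 'r) language" and M :: "('f, 'r, 'a) fo_struct"
  assumes is_structure: "fo_structure L M"
begin

abbreviation "LM \<equiv> lang_over L M"
abbreviation "MM \<equiv> canonical_expansion M"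

lemma univ_MM [simp]: "univ MM = univ M"
  by (simp add: canonical_expansion_def)

lemma fo_structure_MM: "fo_structure LM MM"
  using is_structure by (auto simp: fo_structure_def expand_lang_def canonical_expansion_def)

sublocale cylindric_algebra "univ M" "truth_set MM ` {\<phi>. is_formula LM \<phi>}"
proof
  show "S \<subseteq> assignments (univ M)" if "S \<in> truth_set MM ` {\<phi>. is_formula LM \<phi>}" for S
    using that truth_set_sub[of MM] by auto
  show "assignments (univ M) - S \<in> truth_set MM ` {\<phi>. is_formula LM \<phi>}"
    if S: "S \<in> truth_set MM ` {\<phi>. is_formula LM \<phi>}" for S
  proof -
    obtain \<phi> where "is_formula LM \<phi>" "S = truth_set MM \<phi>" using S by blast
    then show ?thesis by (intro image_eqI[of _ _ "Neg \<phi>"]) (simp_all add: truth_set_Neg)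
  qed
  show "S \<inter> T \<in> truth_set MM ` {\<phi>. is_formula LM \<phi>}"
    if S: "S \<in> truth_set MM ` {\<phi>. is_formula LM \<phi>}"
      and T: "T \<in> truth_set MM ` {\<phi>. is_formula LM \<phi>}" for S T
  proof -
    obtain \<phi> \<psi> where "is_formula LM \<phi>" "S = truth_set MM \<phi>"
      "is_formula LM \<psi>" "T = truth_set MM \<psi>" using S T by blast
    then show ?thesis by (intro image_eqI[of _ _ "Conj \<phi> \<psi>"]) (simp_all add: truth_set_Conj)
  qed
  show "cyl (univ M) x S \<in> truth_set MM ` {\<phi>. is_formula LM \<phi>}"
    if S: "S \<in> truth_set MM ` {\<phi>. is_formula LM \<phi>}" for S x
  proof -
    obtain \<phi> where "is_formula LM \<phi>" "S = truth_set MM \<phi>" using S by blast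
    then show ?thesis by (intro image_eqI[of _ _ "Exi x \<phi>"]) (simp_all add: truth_set_Exi)
  qed
  show "{e \<in> assignments (univ M). e x = e y} \<in> truth_set MM ` {\<phi>. is_formula LM \<phi>}" for x y
    by (intro image_eqI[of _ _ "Equal (Var x) (Var y)"]) (simp_all add: truth_set_def)
  show "{e \<in> assignments (univ M). e x = c} \<in> truth_set MM ` {\<phi>. is_formula LM \<phi>}"
    if "c \<in> univ M" for c x
    using that by (intro image_eqI[of _ _ "Equal (Var x) (App (Inr c) [])"])
      (simp_all add: truth_set_def canonical_expansion_def expand_lang_def)
  show "{e \<in> assignments (univ M). e \<circ> \<rho> \<in> S} \<in> truth_set MM ` {\<phi>. is_formula LM \<phi>}"
    if S: "S \<in> truth_set MM ` {\<phi>. is_formula LM \<phi>}" for S \<rho>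
  proof -
    obtain \<phi> where \<phi>: "is_formula LM \<phi>" "S = truth_set MM \<phi>" using S by blast
    obtain \<phi>' where "is_formula LM \<phi>'" "\<forall>e. sat MM e \<phi>' \<longleftrightarrow> sat MM (\<lambda>x. e (\<rho> x)) \<phi>"
      using ex_renamed_formula[OF \<phi>(1)] by blast
    then have "{e \<in> assignments (univ M). e \<circ> \<rho> \<in> S} = truth_set MM \<phi>'"
      unfolding \<phi>(2) truth_set_def comp_def[symmetric] by auto
    then show ?thesis using \<open>is_formula LM \<phi>'\<close> by blast
  qed
qed

text \<open>Tuples listed along \<open>zs\<close> and restrictions to \<open>set zs\<close> carry the same information, so the
  bounds on the two kinds of fibres agree.\<close>

lemma solutions_fibre:
  assumes "i < length zs"
  shows "{b \<in> solutions MM \<phi> zs. b ! i = a} =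
      (\<lambda>p. map p zs) ` fibre (set zs) (truth_set MM \<phi>) (zs ! i) a"
    and "inj_on (\<lambda>p. map p zs) (fibre (set zs) (truth_set MM \<phi>) (zs ! i) a)"
proof -
  have "map (restrict e (set zs)) zs = map e zs" for e :: "nat \<Rightarrow> 'a" by simp
  then show "{b \<in> solutions MM \<phi> zs. b ! i = a} =
      (\<lambda>p. map p zs) ` fibre (set zs) (truth_set MM \<phi>) (zs ! i) a"
    using assms by (auto simp: solutions_eq fibre_def image_image)
  show "inj_on (\<lambda>p. map p zs) (fibre (set zs) (truth_set MM \<phi>) (zs ! i) a)"
    by (rule inj_onI) (auto simp: fibre_def restrict_def fun_eq_iff)
qed

lemma MA_iff_mut_alg:
  "(\<phi>, zs) \<in> MA L M \<longleftrightarrow>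
     is_formula LM \<phi> \<and> displays zs \<phi> \<and> mut_alg (set zs) (truth_set MM \<phi>)"
proof -
  have "at_most K {b \<in> solutions MM \<phi> zs. b ! i = a} \<longleftrightarrow>
      at_most K (fibre (set zs) (truth_set MM \<phi>) (zs ! i) a)" if "i < length zs" for K i a
    using solutions_fibre[OF that]
    by (simp add: at_most_def card_image finite_image_iff)
  then have "(\<exists>K. \<forall>i<length zs. \<forall>a. at_most K {b \<in> solutions MM \<phi> zs. b ! i = a}) \<longleftrightarrow>
      (\<exists>K. \<forall>v\<in>set zs. \<forall>a. at_most K (fibre (set zs) (truth_set MM \<phi>) v a))"
    unfolding all_set_conv_all_nth by simp
  moreover have "solutions MM \<phi> zs \<subseteq> cart_power (univ M) (length zs)"
    by (auto simp: solutions_def cart_power_def)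
  moreover have "1 \<le> length zs \<longleftrightarrow> set zs \<noteq> {}"
    by (cases zs) auto
  moreover have "supported (univ M) (set zs) (truth_set MM \<phi>)" if "displays zs \<phi>"
    using supported_truth_set[of \<phi> "set zs" MM] that by (simp add: displays_def)
  ultimately show ?thesis
    unfolding MA_def mut_alg_def mutually_algebraic_iff_nth by auto
qed

lemma mut_alg_ex_formula:
  assumes S: "mut_alg V S"
  shows "\<exists>\<phi> zs. (\<phi>, zs) \<in> MA L M \<and> truth_set MM \<phi> = S"
proof -
  obtain \<phi> where \<phi>: "is_formula LM \<phi>" "S = truth_set MM \<phi>" using mut_algD(1)[OF S] by blast
  then obtain \<phi>' where \<phi>': "is_formula LM \<phi>'" "free_vars \<phi>' \<subseteq> V" "truth_set MM \<phi>' = S"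
    using formula_for_support[OF \<phi>(1), of MM V] mut_algD(5)[OF S] by auto
  obtain zs where "set zs = V" "distinct zs"
    using finite_distinct_list[OF mut_algD(3)[OF S]] by blast
  then have "(\<phi>', zs) \<in> MA L M"
    unfolding MA_iff_mut_alg displays_def using \<phi>' S by simp
  then show ?thesis using \<phi>'(3) by blast
qed

lemma boolean_combination_ma_comb:
  "\<psi> \<in> boolean_combinations (fst ` MA L M) \<Longrightarrow> is_formula LM \<psi> \<and> truth_set MM \<psi> \<in> ma_comb"
proof (induction rule: boolean_combinations.induct)
  case (base \<phi>)
  then obtain zs where "(\<phi>, zs) \<in> MA L M" by auto
  then show ?case using ma_comb_mut_alg by (auto simp: MA_iff_mut_alg)
next
  case (neg \<phi>)
  then show ?case using ma_comb_compl[of "truth_set MM \<phi>"] by (simp add: truth_set_Neg)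
next
  case (conj \<phi> \<psi>)
  then show ?case using ma_comb_Int by (simp add: truth_set_Conj)
qed

lemma ma_comb_ex_boolean_combination:
  "S \<in> ma_comb \<Longrightarrow> \<exists>\<psi>\<in>boolean_combinations (fst ` MA L M). truth_set MM \<psi> = S"
proof (induction rule: ma_comb.induct)
  case (ma_comb_mut_alg V S)
  then obtain \<phi> zs where "(\<phi>, zs) \<in> MA L M" "truth_set MM \<phi> = S"
    using mut_alg_ex_formula by blast
  then show ?case
    by (intro bexI[of _ \<phi>] boolean_combinations.base image_eqI[of _ _ "(\<phi>, zs)"]) auto
next
  case (ma_comb_compl S)
  then obtain \<phi> where "\<phi> \<in> boolean_combinations (fst ` MA L M)" "truth_set MM \<phi> = S" by blast
  then show ?case
    by (intro bexI[of _ "Neg \<phi>"] boolean_combinations.neg) (auto simp: truth_set_Neg)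
next
  case (ma_comb_Int S T)
  then obtain \<phi> \<psi> where "\<phi> \<in> boolean_combinations (fst ` MA L M)" "truth_set MM \<phi> = S"
    "\<psi> \<in> boolean_combinations (fst ` MA L M)" "truth_set MM \<psi> = T" by blast
  then show ?case
    by (intro bexI[of _ "Conj \<phi> \<psi>"] boolean_combinations.conj) (auto simp: truth_set_Conj)
qed

text \<open>Equivalence over the theory of the canonical expansion is equality of truth sets in it.\<close>

lemma MA_star_iff: "\<phi> \<in> MA_star L M \<longleftrightarrow> is_formula LM \<phi> \<and> truth_set MM \<phi> \<in> ma_comb"
proof -
  have "equivalent_over TYPE('a) LM (theory_of LM MM) \<phi> \<psi> \<longleftrightarrow>
      truth_set MM \<phi> = truth_set MM \<psi>" if "is_formula LM \<phi>" "is_formula LM \<psi>" for \<psi>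
    using equivalent_over_theory_of(1)[OF fo_structure_MM that] valid_in_Iff[of MM \<phi> \<psi>] by simp
  then show ?thesis
    unfolding MA_star_def
    using boolean_combination_ma_comb ma_comb_ex_boolean_combination[of "truth_set MM \<phi>"]
    by (smt (verit, best) mem_Collect_eq)
qed

lemma MA_star_Exi: "\<phi> \<in> MA_star L M \<Longrightarrow> Exi x \<phi> \<in> MA_star L M"
  using ma_comb_cyl[of "truth_set MM \<phi>" x] by (simp add: MA_star_iff truth_set_Exi)

text \<open>Converts closure properties of sets of assignments back into statements about definable sets of
  tuples.\<close>

lemma ma_comb_image_MA_star_sets:
  assumes S: "S \<in> ma_comb" "supported (univ M) (set zs) S" and zs: "distinct zs"
  shows "(\<lambda>e. map e zs) ` S \<in> MA_star_sets L M (length zs)"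
proof -
  obtain \<phi> where \<phi>: "is_formula LM \<phi>" "S = truth_set MM \<phi>" using ma_comb_D[OF S(1)] by blast
  then obtain \<phi>' where "is_formula LM \<phi>'" "free_vars \<phi>' \<subseteq> set zs" "truth_set MM \<phi>' = S"
    using formula_for_support[OF \<phi>(1), of MM "set zs"] S(2) by auto
  then have "\<phi>' \<in> MA_star L M" "displays zs \<phi>'" "(\<lambda>e. map e zs) ` S = solutions MM \<phi>' zs"
    using S zs by (auto simp: MA_star_iff displays_def solutions_eq)
  then show ?thesis unfolding MA_star_sets_def by blast
qed

abbreviation "FL \<equiv> family_lang (MA_star_sets L M)"
abbreviation "FM \<equiv> family_struct (univ M)"

lemma univ_FM [simp]: "univ FM = univ M"
  by (simp add: family_struct_def)

lemma rel_interp_FM: "rel_interp FM (n, B) as \<longleftrightarrow> as \<in> B"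
  by (simp add: family_struct_def)

lemma family_terms_are_variables: "is_term FL t \<Longrightarrow> \<exists>x. t = Var x"
  by (cases t) (auto simp: family_lang_def)

text \<open>A relation symbol applied to a tuple of variables is a renaming of the set of assignments behind
  the symbol; everything else is closure under the logical operations.\<close>

lemma family_truth_set_ma_comb: "is_formula FL \<psi> \<Longrightarrow> truth_set FM \<psi> \<in> ma_comb"
proof (induction \<psi>)
  case (Equal s t)
  then obtain x y where "s = Var x" "t = Var y"
    using family_terms_are_variables by fastforce
  then have "truth_set FM (Equal s t) = {e \<in> assignments (univ M). e x = e y}"
    by (simp add: truth_set_def)
  then show ?case using ma_comb_mut_alg[OF mut_alg_diag] by simp
next
  case (Rel r ts)
  obtain n B where r: "r = (n, B)" by (cases r)
  have B: "B \<in> MA_star_sets L M n" and len: "length ts = n" and ts: "\<forall>t\<in>set ts. is_term FL t"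
    using Rel by (simp_all add: r family_lang_def)
  have "\<exists>ys. ts = map Var ys"
    using ts family_terms_are_variables by (metis ex_map_conv)
  then obtain ys where ys: "ts = map Var ys" by blast
  obtain \<phi> zs where \<phi>: "\<phi> \<in> MA_star L M" "displays zs \<phi>" "length zs = n" "B = solutions MM \<phi> zs"
    using B unfolding MA_star_sets_def by blast
  then obtain \<rho> where \<rho>: "map \<rho> zs = ys"
    using ex_map_eq[of zs ys] len ys by (auto simp: displays_def)
  have supp: "supported (univ M) (set zs) (truth_set MM \<phi>)"
    using supported_truth_set[of \<phi> "set zs" MM] \<phi>(2) by (simp add: displays_def)
  have sub: "truth_set MM \<phi> \<subseteq> assignments (univ M)"
    using truth_set_sub[of MM \<phi>] by simp
  have "map e ys \<in> B \<longleftrightarrow> e \<circ> \<rho> \<in> truth_set MM \<phi>" if "e \<in> assignments (univ M)" for e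
    using map_mem_image_iff[OF supp assignments_comp[OF that] sub, of \<rho>] \<rho>
    by (simp add: \<phi>(4) solutions_eq flip: map_map)
  then have "truth_set FM (Rel r ts) = {e \<in> assignments (univ M). e \<circ> \<rho> \<in> truth_set MM \<phi>}"
    by (auto simp: truth_set_def[of FM] r ys rel_interp_FM comp_def)
  moreover have "\<dots> \<in> ma_comb"
    using ma_comb_rename \<phi>(1) by (simp add: MA_star_iff)
  ultimately show ?case by simp
next
  case (Neg \<psi>)
  then show ?case using ma_comb_compl[of "truth_set FM \<psi>"] by (simp add: truth_set_Neg)
next
  case (Conj \<psi> \<chi>)
  then show ?case by (simp add: truth_set_Conj ma_comb_Int)
next
  case (Exi x \<psi>)
  then show ?case by (simp add: truth_set_Exi ma_comb_cyl)
qed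

lemma definable_sets_family: "definable_sets FL FM n = MA_star_sets L M n"
proof
  show "definable_sets FL FM n \<subseteq> MA_star_sets L M n"
  proof
    fix B assume "B \<in> definable_sets FL FM n"
    then obtain \<psi> zs where \<psi>: "is_formula FL \<psi>" "displays zs \<psi>" "length zs = n"
      "B = solutions FM \<psi> zs"
      unfolding definable_sets_def by blast
    have "supported (univ M) (set zs) (truth_set FM \<psi>)"
      using supported_truth_set[of \<psi> "set zs" FM] \<psi>(2) by (simp add: displays_def)
    then show "B \<in> MA_star_sets L M n"
      using ma_comb_image_MA_star_sets[OF family_truth_set_ma_comb[OF \<psi>(1)], of zs] \<psi>(2-4)
      by (simp add: solutions_eq displays_def)
  qed
  show "MA_star_sets L M n \<subseteq> definable_sets FL FM n"
  proof
    fix B assume B: "B \<in> MA_star_sets L M n"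
    then obtain \<phi> zs where \<phi>: "displays zs \<phi>" "length zs = n" "B = solutions MM \<phi> zs"
      unfolding MA_star_sets_def by blast
    define \<psi> :: "(unit, nat \<times> 'a list set) form" where "\<psi> = Rel (n, B) (map Var zs)"
    have "solutions FM \<psi> zs = B"
      by (auto simp: \<psi>_def \<phi>(3) solutions_def family_struct_def comp_def canonical_expansion_def)
    moreover have "is_formula FL \<psi>" "displays zs \<psi>"
      using B \<phi>(1,2) by (auto simp: \<psi>_def family_lang_def displays_def)
    ultimately show "B \<in> definable_sets FL FM n"
      unfolding definable_sets_def using \<phi>(2) by blast
  qed
qed

lemma family_is_reduct: "is_reduct_of FL FM LM MM"
proof -
  have "fo_structure FL FM"
    using is_structure by (auto simp: fo_structure_def family_lang_def family_struct_def)
  moreover have "MA_star_sets L M n \<subseteq> definable_sets LM MM n" for n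
    unfolding MA_star_sets_def definable_sets_def MA_star_def by blast
  ultimately show ?thesis
    by (simp add: is_reduct_of_def definable_sets_family)
qed

end

theorem proposition2p7:
  fixes L :: "('f, 'r) language" and M :: "('f, 'r, 'a) fo_struct"
  assumes "fo_structure L M"
  shows "(\<forall>\<phi> x. \<phi> \<in> MA_star L M \<longrightarrow> Exi x \<phi> \<in> MA_star L M) \<and>
    is_reduct_of (family_lang (MA_star_sets L M)) (family_struct (univ M))
      (lang_over L M) (canonical_expansion M) \<and>
    (\<forall>n. definable_sets (family_lang (MA_star_sets L M)) (family_struct (univ M)) n =
      MA_star_sets L M n)"
proof -
  interpret fo_model L M by unfold_locales (rule assms)
  show ?thesis
    using MA_star_Exi family_is_reduct definable_sets_family by blast
qed

end
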